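(* Let $\alpha,\beta>0$ with $\alpha\neq\beta$. Let $X$ and $Y$ be independent, positive, non-Dirac random variables, and set $(U,V)=F^{(\alpha,\beta)}(X,Y)$. If $U$ and $V$ are independent, then there exist $a,b>0$ and $\lambda\in\mathbb{R}$ with $\min\{a,b\}>|\lambda|$ such that $$(X,Y)\sim \mathrm{GB}_{II}(\lambda,a,b;\alpha)\otimes \mathrm{GB}_{II}(-\lambda,a,b;\beta),$$ and consequently $$(U,V)\sim \mathrm{GB}_{II}(-\lambda,a,b;\alpha)\otimes \mathrm{GB}_{II}(\lambda,a,b;\beta).$$
   Context: For $\alpha,\beta>0$ the map $F^{(\alpha,\beta)}\colon(0,\infty)^2\to(0,\infty)^2$ is defined by $$F^{(\alpha,\beta)}(x,y)=\left(\frac{y}{\alpha}\,\frac{\beta+\alpha x+\beta y+\alpha\beta xy}{1+x+y+\beta xy},\;\frac{x}{\beta}\,\frac{\alpha+\alpha x+\beta y+\alpha\beta xy}{1+x+y+\alpha xy}\right).$$ For $\gamma>0$, $p,q>0$ and $-q<\nu<p$, the generalized second kind beta distribution $\mathrm{GB}_{II}(\nu,p,q;\gamma)$ is the probability law on $(0,\infty)$ with density proportional to $$\frac{x^{q+\nu-1}}{(1+\gamma x)^{p+\nu}(1+x)^{q-\nu}}\,\mathbf 1_{(0,\infty)}(x)$$ (the normalizing constant is $\left[B(q+\nu,p-\nu)\,{}_2F_1(p+\nu,q+\nu;p+q;1-\gamma)\right]^{-1}$, where $B$ is the beta function and ${}_2F_1$ the Gauss hypergeometric function). A random variable is non-Dirac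 if it is not almost surely constant. $(X,Y)\sim\mu\otimes\nu$ means that $X$ and $Y$ are independent with laws $\mu$ and $\nu$, respectively. *)

theory Defs
  imports "HOL-Probability.Probability"
begin

definition F_map :: "real \<Rightarrow> real \<Rightarrow> real \<times> real \<Rightarrow> real \<times> real" where
  "F_map \<alpha> \<beta> = (\<lambda>(x, y).
     (y / \<alpha> * ((\<beta> + \<alpha> * x + \<beta> * y + \<alpha> * \<beta> * x * y) / (1 + x + y + \<beta> * x * y)),
      x / \<beta> * ((\<alpha> + \<alpha> * x + \<beta> * y + \<alpha> * \<beta> * x * y) / (1 + x + y + \<alpha> * x * y))))"

definition GB_II_kernel :: "real \<Rightarrow> real \<Rightarrow> real \<Rightarrow> real \<Rightarrow> real \<Rightarrow> real" where
  "GB_II_kernel \<nu> p q \<gamma> x =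
     x powr (q + \<nu> - 1) / ((1 + \<gamma> * x) powr (p + \<nu>) * (1 + x) powr (q - \<nu>)) * indicator {0<..} x"

text \<open>The normalizing constant is written as the reciprocal of the total integral.
  Outside the parameter range of lemma \<open>prob_space_GB_II\<close> this need not be a probability measure.\<close>

definition GB_II :: "real \<Rightarrow> real \<Rightarrow> real \<Rightarrow> real \<Rightarrow> real measure" where
  "GB_II \<nu> p q \<gamma> =
     density lborel (\<lambda>x. ennreal (GB_II_kernel \<nu> p q \<gamma> x / (LINT t|lborel. GB_II_kernel \<nu> p q \<gamma> t)))"

definition non_Dirac :: "'a measure \<Rightarrow> ('a \<Rightarrow> real) \<Rightarrow> bool" where
  "non_Dirac M X \<longleftrightarrow> \<not> (\<exists>c. AE \<omega> in M. X \<omega> = c)"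

definition indep_with_laws ::
  "'a measure \<Rightarrow> ('a \<Rightarrow> real) \<Rightarrow> ('a \<Rightarrow> real) \<Rightarrow> real measure \<Rightarrow> real measure \<Rightarrow> bool" where
  "indep_with_laws M X Y \<mu> \<nu> \<longleftrightarrow>
     prob_space.indep_var M borel X borel Y \<and> distr M borel X = \<mu> \<and> distr M borel Y = \<nu>"

lemma GB_II_kernel_measurable [measurable]: "GB_II_kernel \<nu> p q \<gamma> \<in> borel_measurable borel"
  unfolding GB_II_kernel_def [abs_def] by measurable

lemma GB_II_kernel_nonneg: "0 \<le> GB_II_kernel \<nu> p q \<gamma> x"
  by (simp add: GB_II_kernel_def)

lemma powr_le_ends:
  fixes r e l u :: real
  assumes "0 < l" "l \<le> r" "r \<le> u"
  shows "r powr e \<le> l powr e + u powr e"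
proof (cases "e \<ge> 0")
  case True
  then have "r powr e \<le> u powr e" using assms by (intro powr_mono2) auto
  then show ?thesis by (simp add: add_increasing)
next
  case False
  then have "r powr e \<le> l powr e" using assms by (intro powr_mono2') auto
  then show ?thesis by (simp add: add_increasing2)
qed

lemma integrable_GB_II_kernel:
  fixes \<gamma> p q \<nu> :: real
  assumes "\<gamma> > 0" "p > 0" "q > 0" "- q < \<nu>" "\<nu> < p"
  shows "integrable lborel (GB_II_kernel \<nu> p q \<gamma>)"
proof -
  define C where "C = (min 1 (1/\<gamma>)) powr (p + \<nu>) + (max 1 (1/\<gamma>)) powr (p + \<nu>)"
  have C: "C \<ge> 0" by (simp add: C_def)
  have key: "x powr (q + \<nu> - 1) / ((1 + \<gamma> * x) powr (p + \<nu>) * (1 + x) powr (q - \<nu>))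
       \<le> C * (x powr (q + \<nu> - 1) * (1 + x) powr (-(p + q)))" if x: "x > 0" for x :: real
  proof -
    have pos: "1 + \<gamma> * x > 0" using x assms by (simp add: add_pos_pos)
    have r1: "min 1 (1/\<gamma>) \<le> (1 + x) / (1 + \<gamma> * x)"
      using x assms pos
      by (cases "\<gamma> \<le> 1") (auto simp: min_def divide_simps mult_right_mono algebra_simps)
    have r2: "(1 + x) / (1 + \<gamma> * x) \<le> max 1 (1/\<gamma>)"
      using x assms pos
      by (cases "\<gamma> \<le> 1") (auto simp: max_def divide_simps mult_right_mono algebra_simps)
    have "((1 + x) / (1 + \<gamma> * x)) powr (p + \<nu>) \<le> C"
      unfolding C_def using r1 r2 assms by (intro powr_le_ends) auto
    moreover have "1 / ((1 + \<gamma> * x) powr (p + \<nu>) * (1 + x) powr (q - \<nu>))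
        = ((1 + x) / (1 + \<gamma> * x)) powr (p + \<nu>) * (1 + x) powr (-(p + q))"
    proof -
      have "(1 + x) powr (-(p + q)) = 1 / ((1 + x) powr (p + \<nu>) * (1 + x) powr (q - \<nu>))"
        using x by (simp add: powr_minus powr_add [symmetric] divide_simps algebra_simps)
      then show ?thesis using x pos by (simp add: powr_divide)
    qed
    ultimately have "1 / ((1 + \<gamma> * x) powr (p + \<nu>) * (1 + x) powr (q - \<nu>))
        \<le> C * (1 + x) powr (-(p + q))"
      by (simp add: mult_right_mono)
    then have "x powr (q + \<nu> - 1) * (1 / ((1 + \<gamma> * x) powr (p + \<nu>) * (1 + x) powr (q - \<nu>)))
        \<le> x powr (q + \<nu> - 1) * (C * (1 + x) powr (-(p + q)))"
      by (intro mult_left_mono) auto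
    then show ?thesis by (simp add: mult_ac)
  qed
  have I1: "(\<lambda>x. x powr (q + \<nu> - 1)) absolutely_integrable_on {0..1::real}"
    using has_integral_powr_from_0 [of "q + \<nu> - 1" 1] assms
    by (intro nonnegative_absolutely_integrable_1) (auto simp: integrable_on_def)
  have I2: "(\<lambda>x. x powr (\<nu> - p - 1)) absolutely_integrable_on {1::real..}"
    using has_integral_powr_to_inf [of "\<nu> - p - 1" 1] assms
    by (intro nonnegative_absolutely_integrable_1) (auto simp: integrable_on_def)
  have J1: "set_integrable lborel {0..1::real} (\<lambda>x. x powr (q + \<nu> - 1))"
    using I1 by (auto simp: set_integrable_def intro!: integrable_completion[THEN iffD1])
  have J2: "set_integrable lborel {1::real..} (\<lambda>x. x powr (\<nu> - p - 1))"
    using I2 by (auto simp: set_integrable_def intro!: integrable_completion[THEN iffD1])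
  have J: "integrable lborel (\<lambda>x. C * (indicator {0..1} x *\<^sub>R x powr (q + \<nu> - 1)
               + indicator {1..} x *\<^sub>R x powr (\<nu> - p - 1)))"
    using J1 J2 unfolding set_integrable_def by simp
  show ?thesis
  proof (rule Bochner_Integration.integrable_bound [OF J])
    show "AE x in lborel. norm (GB_II_kernel \<nu> p q \<gamma> x) \<le>
      norm (C * (indicator {0..1} x *\<^sub>R x powr (q + \<nu> - 1) + indicator {1..} x *\<^sub>R x powr (\<nu> - p - 1)))"
    proof (intro AE_I2)
      fix x :: real
      have "GB_II_kernel \<nu> p q \<gamma> x \<le>
        C * (indicator {0..1} x *\<^sub>R x powr (q + \<nu> - 1) + indicator {1..} x *\<^sub>R x powr (\<nu> - p - 1))"
      proof (cases "x > 0")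
        case False
        then show ?thesis using C by (auto simp: GB_II_kernel_def)
      next
        case x: True
        have "x powr (q + \<nu> - 1) * (1 + x) powr (-(p + q)) \<le>
          indicator {0..1} x *\<^sub>R x powr (q + \<nu> - 1) + indicator {1..} x *\<^sub>R x powr (\<nu> - p - 1)"
        proof (cases "x \<le> 1")
          case True
          have "(1 + x) powr (-(p + q)) \<le> 1"
            using x assms powr_mono2' [of "-(p+q)" 1 "1 + x"] by simp
          then have "x powr (q + \<nu> - 1) * (1 + x) powr (-(p + q)) \<le> x powr (q + \<nu> - 1)"
            by (simp add: mult_left_le)
          then show ?thesis using True x by (auto intro: order_trans add_increasing2)
        next
          case False
          have "(1 + x) powr (-(p + q)) \<le> x powr (-(p + q))"
            using x assms by (intro powr_mono2') auto
          then have "x powr (q + \<nu> - 1) * (1 + x) powr (-(p + q))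
              \<le> x powr (q + \<nu> - 1) * x powr (-(p + q))"
            by (intro mult_left_mono) auto
          also have "\<dots> = x powr (\<nu> - p - 1)"
            using x by (simp add: powr_add [symmetric] algebra_simps)
          finally show ?thesis using False x by auto
        qed
        then have "C * (x powr (q + \<nu> - 1) * (1 + x) powr (-(p + q))) \<le>
          C * (indicator {0..1} x *\<^sub>R x powr (q + \<nu> - 1) + indicator {1..} x *\<^sub>R x powr (\<nu> - p - 1))"
          using C by (rule mult_left_mono)
        with key [OF x] show ?thesis using x by (simp add: GB_II_kernel_def)
      qed
      then show "norm (GB_II_kernel \<nu> p q \<gamma> x) \<le>
        norm (C * (indicator {0..1} x *\<^sub>R x powr (q + \<nu> - 1) + indicator {1..} x *\<^sub>R x powr (\<nu> - p - 1)))"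
        using GB_II_kernel_nonneg [of \<nu> p q \<gamma> x] by simp
    qed
  qed simp
qed

lemma prob_space_GB_II:
  fixes \<gamma> p q \<nu> :: real
  assumes "\<gamma> > 0" "p > 0" "q > 0" "- q < \<nu>" "\<nu> < p"
  shows "prob_space (GB_II \<nu> p q \<gamma>)"
proof -
  let ?k = "GB_II_kernel \<nu> p q \<gamma>"
  define I where "I = (LINT t|lborel. ?k t)"
  have int: "integrable lborel ?k" using assms by (rule integrable_GB_II_kernel)
  have "I \<noteq> 0"
  proof
    assume "I = 0"
    then have "AE x in lborel. ?k x = 0"
      using integral_nonneg_eq_0_iff_AE [OF int] GB_II_kernel_nonneg unfolding I_def by auto
    then have "AE x in lborel. x \<notin> {0<..<1::real}"
    proof eventually_elim
      case (elim x)
      show ?case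
      proof
        assume "x \<in> {0<..<1}"
        moreover from this have "1 + \<gamma> * x > 0" using assms by (simp add: add_pos_pos)
        ultimately show False using elim by (simp add: GB_II_kernel_def)
      qed
    qed
    then have "emeasure lborel {0<..<1::real} = 0"
      by (subst (asm) AE_iff_measurable [where N = "{0<..<1}"]) auto
    then show False by simp
  qed
  moreover have "I \<ge> 0" unfolding I_def by (simp add: GB_II_kernel_nonneg)
  ultimately have I: "I > 0" by simp
  have "(\<integral>\<^sup>+ x. ennreal (?k x / I) \<partial>lborel) = ennreal (LINT x|lborel. ?k x / I)"
    using int I by (intro nn_integral_eq_integral) (auto simp: GB_II_kernel_nonneg)
  also have "\<dots> = 1" using I by (simp add: I_def)
  finally show ?thesis
    unfolding GB_II_def I_def [symmetric]
    by (intro prob_spaceI) (simp add: emeasure_density)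
qed

end

theory Submission
  imports Defs "HOL-Complex_Analysis.Complex_Analysis"
begin

text \<open>
  For $\gamma, x > 0$ consider the four quantities
  \<^item> $A = x/(1+x)$ and $Q = 1/(1+x)$,
  \<^item> $P = \gamma x/(1+\gamma x)$ and $B = 1/(1+\gamma x)$.

  They lie in $(0,1)$ and satisfy $A + Q = 1$, $P + B = 1$ and $PQ = \gamma AB$. The map $F^{(\alpha,\beta)}$
  is multiplicative in them: if $(u,v)$ is the image of $(x,y)$, then, with parameter $\alpha$ for $x, u$
  and $\beta$ for $y, v$,
  $$A_x A_y = A_u A_v,\quad B_x B_y = B_u B_v,\quad P_x Q_y = Q_u P_v,\quad Q_x P_y = P_u Q_v.$$
  So the independence of both pairs implies that the moments $f, g, h, k$ of the monomials
  $A^a B^b P^p Q^q$ under the laws of $X, Y, U, V$ (with $p$ and $q$ exchanged for $Y$ and $U$) satisfy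
  $f g = h k$ at every exponent $w = (a,b,p,q) \ge 0$. All these moments are finite because the four
  quantities are bounded. The theorem is extracted from this
  functional equation and from the linear relations that $A + Q = 1$, $P + B = 1$, $PQ = \gamma AB$
  induce between neighbouring moments. Below, $f_A$ denotes $f$ at $w + A$, that is, with the exponent of $A$
  raised by one.

  The first point is a dichotomy. At a fixed $w$, the pairs $(h_A/h, h_Q/h)$ and $(g_A/g, g_Q/g)$ solve the same
  $2 \times 2$ linear system, whose coefficients are values of $\tau = f/h = k/g$. Hence either
  the two pairs agree (\<open>swap\<close>) or the determinant
  $\tau_A \tau_B - \tau_P \tau_Q$ vanishes. The swap is what the map exchanging $x$ and $y$ would give;
  if it held at $w$, $w + A$ and $w + P$, it would force $\alpha = \beta$. Moments depend analytically on a real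
  exponent, so if the determinant were nonzero at $w$, the swap would propagate from $w$ along
  whole rays to $w + A$ and $w + P$. Therefore the determinant vanishes everywhere (\<open>det_zero\<close>).

  The second point is that $\tau$ is now completely rigid on the lattice of integer exponents. Solvability of the
  degenerate system gives one more relation, and eliminating $f_{AB}$ and $h_{AB}$ gives
  $\tau_{AB}\,\tau = \tau_A \tau_B$ (here one of $\alpha, \beta$ is different from $1$). Together these say
  that the ratios of $\tau$ at neighbouring points are
  $$\tau_A : \tau = l : m,\quad \tau_P : \tau = l : n,\quad \tau_B : \tau = s : n,\quad \tau_Q : \tau = s : m,
    \qquad l + s = m + n,$$
  with positive $l, m, n, s$ that are affine functions of $w$: a shift by $A$, $P$, $B$ or $Q$ adds one and the
  same number $e \ge 0$ to the two coordinates in the corresponding ratio and leaves the other two alone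
  (\<open>rep_affine\<close>). For Gauss hypergeometric moments this is the Euler transformation together with the
  functional equation of the gamma function. Substituted back, it yields
  $m f_A + n f_P = l f$ and its analogues for $g, h, k$. If $e = 0$, then these relations say that
  $m A + n P - l$ has second moment zero, so that $X$ is constant; hence $e > 0$ and, after scaling, $e = 1$.

  The third point identifies the law. Along the exponents $(0,0,k,0)$ the relation is a Stein identity
  $$\mathrm{E}\bigl[X \Psi'(X) + (l - m A - n P)\,\Psi(X)\bigr] = 0$$
  for the polynomials $\Psi$ in $P$ that vanish at $P = 0$. By the Weierstrass theorem it extends to all continuously
  differentiable functions of $P$ on $[0,1]$ with this property, and solving $X\Psi' + (l - mA - nP)\Psi = \varphi$ for test functions $\varphi$ shows that the law is the one
  with density proportional to $x^{l-1}(1+\gamma x)^{-n}(1+x)^{-m}$ (\<open>GB_II_from_Stein_identities\<close>).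
  The inequality $\min\{a,b\} > |\lambda|$ is the positivity of $l, m, n, s$.
\<close>

section \<open>Moments of bounded monomials\<close>

text \<open>
  Cutting off at $x \le 0$ makes the monomials with nonnegative exponents bounded by $1$ on the whole line, so that only the almost sure
  positivity of the laws has to be carried along.
\<close>

definition kern :: "real \<Rightarrow> real \<Rightarrow> real \<Rightarrow> real \<Rightarrow> real \<Rightarrow> real \<Rightarrow> real" where
  "kern \<gamma> a b p q x = (if x > 0 then (x/(1+x)) powr a * (1/(1+\<gamma>*x)) powr b * (\<gamma>*x/(1+\<gamma>*x)) powr p * (1/(1+x)) powr q else 0)"

definition mom :: "real \<Rightarrow> real measure \<Rightarrow> real \<Rightarrow> real \<Rightarrow> real \<Rightarrow> real \<Rightarrow> real" where
  "mom \<gamma> \<mu> a b p q = (LINT x|\<mu>. kern \<gamma> a b p q x)"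

lemma kern_measurable [measurable]: "kern \<gamma> a b p q \<in> borel_measurable borel"
  unfolding kern_def[abs_def] by measurable

context
  fixes \<gamma> :: real assumes g: "\<gamma> > 0"
begin

lemma coords:
  assumes "x > 0"
  shows "0 < x/(1+x)" "x/(1+x) < 1" "0 < 1/(1+x)" "1/(1+x) < 1"
    "0 < \<gamma>*x/(1+\<gamma>*x)" "\<gamma>*x/(1+\<gamma>*x) < 1" "0 < 1/(1+\<gamma>*x)" "1/(1+\<gamma>*x) < 1" "1 + \<gamma> * x > 0"
proof -
  have "\<gamma> * x > 0" using assms g by simp
  then show "0 < x/(1+x)" "x/(1+x) < 1" "0 < 1/(1+x)" "1/(1+x) < 1"
    "0 < \<gamma>*x/(1+\<gamma>*x)" "\<gamma>*x/(1+\<gamma>*x) < 1" "0 < 1/(1+\<gamma>*x)" "1/(1+\<gamma>*x) < 1" "1 + \<gamma> * x > 0"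
    using assms by (auto simp: divide_simps)
qed

lemma kern_pos: "x > 0 \<Longrightarrow> kern \<gamma> a b p q x > 0"
  using coords[of x] g unfolding kern_def by (simp only: if_True) (intro mult_pos_pos; simp)

lemma kern_nonneg: "kern \<gamma> a b p q x \<ge> 0"
  by (simp add: kern_def)

lemma kern_le_1:
  assumes "a \<ge> 0" "b \<ge> 0" "p \<ge> 0" "q \<ge> 0"
  shows "kern \<gamma> a b p q x \<le> 1"
proof (cases "x > 0")
  case True
  have p: "y powr c \<le> 1" if "0 < y" "y < 1" "c \<ge> 0" for y c :: real
    using powr_mono2[of c y 1] that by simp
  show ?thesis using True coords[OF True] assms unfolding kern_def
    by (simp only: if_True) (intro mult_le_one p mult_nonneg_nonneg powr_ge_zero)
qed (simp add: kern_def)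

lemma kern_shift:
  assumes "x > 0"
  shows "kern \<gamma> (a+1) b p q x = kern \<gamma> a b p q x * (x/(1+x))"
    and "kern \<gamma> a (b+1) p q x = kern \<gamma> a b p q x * (1/(1+\<gamma>*x))"
    and "kern \<gamma> a b (p+1) q x = kern \<gamma> a b p q x * (\<gamma>*x/(1+\<gamma>*x))"
    and "kern \<gamma> a b p (q+1) x = kern \<gamma> a b p q x * (1/(1+x))"
proof -
  have powr1: "y powr (c + 1) = y powr c * y" if "y > 0" for y c :: real
    using that by (simp add: powr_add)
  show "kern \<gamma> (a+1) b p q x = kern \<gamma> a b p q x * (x/(1+x))"
    "kern \<gamma> a (b+1) p q x = kern \<gamma> a b p q x * (1/(1+\<gamma>*x))"
    "kern \<gamma> a b (p+1) q x = kern \<gamma> a b p q x * (\<gamma>*x/(1+\<gamma>*x))"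
    "kern \<gamma> a b p (q+1) x = kern \<gamma> a b p q x * (1/(1+x))"
    using assms unfolding kern_def
    by (simp_all only: if_True powr1[OF coords(1)[OF assms]] powr1[OF coords(3)[OF assms]]
        powr1[OF coords(5)[OF assms]] powr1[OF coords(7)[OF assms]] mult_ac)
qed

lemma kern_AQ: "kern \<gamma> (a+1) b p q x + kern \<gamma> a b p (q+1) x = kern \<gamma> a b p q x"
proof (cases "x > 0")
  case True
  have "x/(1+x) + 1/(1+x) = 1" using True by (simp add: divide_simps)
  then show ?thesis unfolding kern_shift[OF True] by (metis distrib_left mult.right_neutral)
qed (simp add: kern_def)

lemma kern_BP: "kern \<gamma> a (b+1) p q x + kern \<gamma> a b (p+1) q x = kern \<gamma> a b p q x"
proof (cases "x > 0")
  case True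
  have "1/(1+\<gamma>*x) + \<gamma>*x/(1+\<gamma>*x) = 1" using coords[OF True] by (simp add: divide_simps)
  then show ?thesis unfolding kern_shift[OF True] by (metis distrib_left mult.right_neutral)
qed (simp add: kern_def)

lemma kern_PQ: "kern \<gamma> a b (p+1) (q+1) x = \<gamma> * kern \<gamma> (a+1) (b+1) p q x"
proof (cases "x > 0")
  case True
  then show ?thesis unfolding kern_shift[OF True] by (simp add: mult_ac)
qed (simp add: kern_def)

end

locale pos_law = prob_space \<mu> for \<mu> :: "real measure" +
  fixes \<gamma> :: real
  assumes sets_law [measurable_cong]: "sets \<mu> = sets borel" and AE_pos: "AE x in \<mu>. x > 0" and \<gamma>_pos: "\<gamma> > 0"
begin

lemma kern_integrable:
  "a \<ge> 0 \<Longrightarrow> b \<ge> 0 \<Longrightarrow> p \<ge> 0 \<Longrightarrow> q \<ge> 0 \<Longrightarrow> integrable \<mu> (kern \<gamma> a b p q)"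
  by (rule integrable_const_bound[where B = 1])
     (auto simp: kern_le_1[OF \<gamma>_pos] kern_nonneg[OF \<gamma>_pos] abs_of_nonneg)

lemma mom_pos:
  assumes "a \<ge> 0" "b \<ge> 0" "p \<ge> 0" "q \<ge> 0" shows "mom \<gamma> \<mu> a b p q > 0"
proof -
  have "mom \<gamma> \<mu> a b p q \<noteq> 0"
  proof
    assume "mom \<gamma> \<mu> a b p q = 0"
    then have "AE x in \<mu>. kern \<gamma> a b p q x = 0"
      using integral_nonneg_eq_0_iff_AE[OF kern_integrable[OF assms]] kern_nonneg[OF \<gamma>_pos]
      by (simp add: mom_def)
    with AE_pos have "AE x in \<mu>. False"
      by eventually_elim (use kern_pos[OF \<gamma>_pos, of _ a b p q] in force)
    then show False by simp
  qed
  moreover have "mom \<gamma> \<mu> a b p q \<ge> 0"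
    unfolding mom_def by (intro Bochner_Integration.integral_nonneg kern_nonneg[OF \<gamma>_pos])
  ultimately show ?thesis by simp
qed

lemma mom_AQ:
  assumes "a \<ge> 0" "b \<ge> 0" "p \<ge> 0" "q \<ge> 0" 
  shows "mom \<gamma> \<mu> (a+1) b p q + mom \<gamma> \<mu> a b p (q+1) = mom \<gamma> \<mu> a b p q"
  unfolding mom_def using assms
  by (subst Bochner_Integration.integral_add[symmetric]) (auto intro!: kern_integrable simp: kern_AQ[OF \<gamma>_pos])

lemma mom_BP:
  assumes "a \<ge> 0" "b \<ge> 0" "p \<ge> 0" "q \<ge> 0" 
  shows "mom \<gamma> \<mu> a (b+1) p q + mom \<gamma> \<mu> a b (p+1) q = mom \<gamma> \<mu> a b p q"
  unfolding mom_def using assms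
  by (subst Bochner_Integration.integral_add[symmetric]) (auto intro!: kern_integrable simp: kern_BP[OF \<gamma>_pos])

lemma mom_PQ: "mom \<gamma> \<mu> a b (p+1) (q+1) = \<gamma> * mom \<gamma> \<mu> (a+1) (b+1) p q"
  unfolding mom_def kern_PQ[OF \<gamma>_pos, abs_def] by simp

lemma mom_AB:
  assumes "a \<ge> 0" "b \<ge> 0" "p \<ge> 0" "q \<ge> 0" 
  shows "mom \<gamma> \<mu> (a+1) b p q - mom \<gamma> \<mu> a b (p+1) q = (1 - \<gamma>) * mom \<gamma> \<mu> (a+1) (b+1) p q"
  using mom_BP[of "a+1" b p q] mom_AQ[of a b "p+1" q] mom_PQ[of a b p q] assms by (simp add: algebra_simps)

end

section \<open>Analytic dependence on an exponent\<close>

text \<open>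
  Moments are functions of this kind in each exponent. The exponent zero is on the boundary of the domain of
  holomorphy, which is why right continuity there is recorded separately.
\<close>

definition right_analytic :: "(real \<Rightarrow> real) \<Rightarrow> bool" where
  "right_analytic f \<longleftrightarrow> (f \<longlongrightarrow> f 0) (at_right 0) \<and>
     (\<exists>F. F holomorphic_on {s. Re s > 0} \<and> (\<forall>t>0. F (of_real t) = of_real (f t)))"

lemma right_analytic_mult: "right_analytic f \<Longrightarrow> right_analytic g \<Longrightarrow> right_analytic (\<lambda>t. f t * g t)"
  unfolding right_analytic_def
  by (safe; (intro tendsto_mult; assumption)?)
     (rule_tac x = "\<lambda>s. F s * Fa s" in exI, auto intro!: holomorphic_intros)

lemma right_analytic_diff: "right_analytic f \<Longrightarrow> right_analytic g \<Longrightarrow> right_analytic (\<lambda>t. f t - g t)"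
  unfolding right_analytic_def
  by (safe; (intro tendsto_diff; assumption)?)
     (rule_tac x = "\<lambda>s. F s - Fa s" in exI, auto intro!: holomorphic_intros)

text \<open>
  By continuity $w$ does not vanish near $0$, so $z$ vanishes on an interval and hence identically, by the
  identity theorem.
\<close>

lemma right_analytic_zero_product:
  assumes z: "right_analytic z" and w: "right_analytic w"
    and zw: "\<And>t. t \<ge> 0 \<Longrightarrow> z t * w t = 0" and w0: "w 0 \<noteq> 0" and t: "t \<ge> 0"
  shows "z t = 0"
proof (cases "t = 0")
  case False
  with t have t: "t > 0" by simp
  obtain F where F: "F holomorphic_on {s. Re s > 0}" "\<And>t. t > 0 \<Longrightarrow> F (of_real t) = of_real (z t)"
    using z by (auto simp: right_analytic_def)
  have "(w \<longlongrightarrow> w 0) (at_right 0)" using w by (simp add: right_analytic_def)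
  then have "eventually (\<lambda>t. w t \<noteq> 0) (at_right 0)" using w0 by (rule tendsto_imp_eventually_ne)
  then obtain d where d: "d > 0" "\<And>t. 0 < t \<Longrightarrow> t < d \<Longrightarrow> w t \<noteq> 0"
    unfolding eventually_at_right_field by auto
  have F0: "F (of_real s) = 0" if "0 < s" "s < d" for s
    using zw[of s] d(2)[of s] F(2)[of s] that by simp
  have "F (of_real t) = 0"
  proof (rule analytic_continuation[OF F(1), of "of_real ` {0<..<d}" "of_real (d/2)"])
    show "open {s. 0 < Re s}" by (rule open_halfspace_Re_gt)
    show "connected {s. 0 < Re s}" by (intro convex_connected convex_halfspace_Re_gt)
    have "(d/2) islimpt {0<..<d}"
      using d(1) by (intro open_imp_islimpt) auto
    then show "complex_of_real (d/2) islimpt complex_of_real ` {0<..<d}"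
      by (intro islimpt_isCont_image) (auto simp: eventually_at_filter simp del: of_real_divide)
  qed (use d t F0 in auto)
  then show ?thesis using F(2)[OF t] by simp
qed (use zw[of 0] w0 in auto)

text \<open>
  Powers $y^t$ with $0 < y \le 1$ are written $e^{-tL}$ with $L = -\ln y \ge 0$. The function $L$ may be unbounded, but
  differentiation under the integral is legitimate on $\mathrm{Re}\, s > d > 0$, because $L e^{-dL} \le 1/d$
  dominates all difference quotients.
\<close>

lemma right_analytic_laplace:
  fixes \<mu> :: "real measure"
  assumes "finite_measure \<mu>" and m[measurable]: "m \<in> borel_measurable \<mu>" and L[measurable]: "L \<in> borel_measurable \<mu>"
    and m1: "AE x in \<mu>. \<bar>m x\<bar> \<le> 1" and L0: "AE x in \<mu>. L x \<ge> 0"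
  shows "right_analytic (\<lambda>t. LINT x|\<mu>. m x * exp (- (t * L x)))"
proof -
  interpret finite_measure \<mu> by fact
  define F where "F s = (LINT x|\<mu>. of_real (m x) * exp (- (s * of_real (L x))))" for s :: complex
  have int: "integrable \<mu> (\<lambda>x. of_real (m x) * exp (- (s * of_real (L x))))" if "Re s \<ge> 0" for s :: complex
  proof (rule integrable_const_bound[where B = 1])
    show "AE x in \<mu>. norm (complex_of_real (m x) * exp (- (s * complex_of_real (L x)))) \<le> 1"
      using m1 L0
    proof eventually_elim
      case (elim x)
      then have "exp (- (Re s * L x)) \<le> 1" using that by simp
      then have "\<bar>m x\<bar> * exp (- (Re s * L x)) \<le> 1 * 1" using elim by (intro mult_mono) auto
      then show ?case by (simp add: norm_mult)
    qed
  qed measurable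
  have "\<exists>D. (F has_field_derivative D) (at s)" if s: "Re s > 0" for s
  proof -
    define d where "d = Re s / 2"
    define S where "S = {y. Re y > d}"
    have d: "d > 0" and sS: "s \<in> S" using s by (auto simp: d_def S_def)
    have cS: "convex S" "open S" unfolding S_def by (auto intro: convex_halfspace_Re_gt open_halfspace_Re_gt)
    define D where "D = (LINT x|\<mu>. of_real (m x) * (- of_real (L x) * exp (- (s * of_real (L x)))))"
    have der: "((\<lambda>y. exp (- (y * of_real l))) has_field_derivative - of_real l * exp (- (y * of_real l))) (at y within A)" for l and y :: complex and A
      by (auto intro!: derivative_eq_intros)
    have lip: "norm (exp (- (y * of_real l)) - exp (- (s * of_real l))) \<le> 1 / d * norm (y - s)" if "y \<in> S" "l \<ge> 0" for y and l :: real
    proof (rule field_differentiable_bound[OF cS(1) der _ that(1) sS])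
      fix y assume y: "y \<in> S"
      \<comment> \<open>the domination $l e^{-dl} \le 1/d$, from $dl \le e^{dl}$\<close>
      have "d * l \<le> Re y * l" using y that(2) by (intro mult_right_mono) (auto simp: S_def)
      moreover have "d * l \<le> exp (d * l)" using exp_ge_add_one_self[of "d * l"] by linarith
      ultimately have "d * l \<le> exp (Re y * l)" by (meson exp_le_cancel_iff order.trans)
      then have "l * exp (- (Re y * l)) \<le> 1 / d" using d by (simp add: exp_minus field_simps)
      then show "norm (- complex_of_real l * exp (- (y * of_real l))) \<le> 1 / d"
        using that(2) by (simp add: norm_mult)
    qed
    have "((\<lambda>y. (F y - F s) / (y - s)) \<longlongrightarrow> D) (at s within S)"
      unfolding tendsto_at_iff_sequentially comp_def
    proof (intro allI impI)
      fix Y assume Y: "\<forall>i. Y i \<in> S - {s}" and lim: "Y \<longlonglongrightarrow> s"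
      have "(\<lambda>i. LINT x|\<mu>. of_real (m x) * ((exp (- (Y i * of_real (L x))) - exp (- (s * of_real (L x)))) / (Y i - s))) \<longlonglongrightarrow> D"
        unfolding D_def
      proof (rule integral_dominated_convergence[where w = "\<lambda>_. 1 / d"])
        show "AE x in \<mu>. (\<lambda>i. of_real (m x) * ((exp (- (Y i * of_real (L x))) - exp (- (s * of_real (L x)))) / (Y i - s)))
          \<longlonglongrightarrow> of_real (m x) * (- of_real (L x) * exp (- (s * of_real (L x))))"
        proof (intro AE_I2 tendsto_mult_left)
          fix x
          from der[of "L x" s S] have "((\<lambda>y. (exp (- (y * of_real (L x))) - exp (- (s * of_real (L x)))) / (y - s)) \<longlongrightarrow> - of_real (L x) * exp (- (s * of_real (L x)))) (at s within S)"
            by (simp add: has_field_derivative_iff)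
          then show "(\<lambda>i. (exp (- (Y i * of_real (L x))) - exp (- (s * of_real (L x)))) / (Y i - s)) \<longlonglongrightarrow> - of_real (L x) * exp (- (s * of_real (L x)))"
            using Y lim unfolding tendsto_at_iff_sequentially comp_def by blast
        qed
        show "AE x in \<mu>. norm (complex_of_real (m x) * ((exp (- (Y i * of_real (L x))) - exp (- (s * of_real (L x)))) / (Y i - s))) \<le> 1 / d" for i
          using m1 L0
        proof eventually_elim
          case (elim x)
          have "norm (Y i - s) > 0" using Y by simp
          then have "norm ((exp (- (Y i * of_real (L x))) - exp (- (s * of_real (L x)))) / (Y i - s)) \<le> 1 / d"
            using lip[of "Y i" "L x"] Y elim by (simp add: norm_divide pos_divide_le_eq)
          then have "\<bar>m x\<bar> * norm ((exp (- (Y i * of_real (L x))) - exp (- (s * of_real (L x)))) / (Y i - s)) \<le> 1 * (1 / d)"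
            using elim by (intro mult_mono) auto
          then show ?case unfolding norm_mult norm_of_real by simp
        qed
      qed auto
      moreover have "(F (Y i) - F s) / (Y i - s) = (LINT x|\<mu>. of_real (m x) * ((exp (- (Y i * of_real (L x))) - exp (- (s * of_real (L x)))) / (Y i - s)))" for i
      proof -
        have "Y i \<in> S" using Y by blast
        then have "Re (Y i) \<ge> 0" using d by (simp add: S_def)
        then have "F (Y i) - F s = (LINT x|\<mu>. of_real (m x) * exp (- (Y i * of_real (L x))) - of_real (m x) * exp (- (s * of_real (L x))))"
          unfolding F_def using s by (intro Bochner_Integration.integral_diff[symmetric] int) auto
        then have "(F (Y i) - F s) / (Y i - s) = (LINT x|\<mu>. (of_real (m x) * exp (- (Y i * of_real (L x))) - of_real (m x) * exp (- (s * of_real (L x)))) / (Y i - s))"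
          by simp
        then show ?thesis by (simp only: right_diff_distrib[symmetric] times_divide_eq_right)
      qed
      ultimately show "(\<lambda>i. (F (Y i) - F s) / (Y i - s)) \<longlonglongrightarrow> D" by (simp only:)
    qed
    then have "(F has_field_derivative D) (at s within S)" by (simp add: has_field_derivative_iff)
    then show ?thesis using at_within_open[OF sS cS(2)] by auto
  qed
  then have hol: "F holomorphic_on {s. Re s > 0}"
    by (intro holomorphic_onI) (auto simp: field_differentiable_def intro: has_field_derivative_at_within)
  have real: "F (of_real t) = of_real (LINT x|\<mu>. m x * exp (- (t * L x)))" if "t > 0" for t
  proof -
    have "complex_of_real (m x) * exp (- (of_real t * of_real (L x))) = of_real (m x * exp (- (t * L x)))" for x
      by (metis exp_of_real of_real_minus of_real_mult)
    then show ?thesis unfolding F_def by (simp only: integral_complex_of_real)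
  qed
  have "((\<lambda>t. LINT x|\<mu>. m x * exp (- (t * L x))) \<longlongrightarrow> (LINT x|\<mu>. m x * exp (- (0 * L x)))) (at_right 0)"
    unfolding tendsto_at_iff_sequentially comp_def
  proof (intro allI impI)
    fix Y :: "nat \<Rightarrow> real" assume Y: "\<forall>i. Y i \<in> {0<..} - {0}" and lim: "Y \<longlonglongrightarrow> 0"
    show "(\<lambda>i. LINT x|\<mu>. m x * exp (- (Y i * L x))) \<longlonglongrightarrow> (LINT x|\<mu>. m x * exp (- (0 * L x)))"
    proof (rule integral_dominated_convergence[where w = "\<lambda>_. 1"])
      show "AE x in \<mu>. (\<lambda>i. m x * exp (- (Y i * L x))) \<longlonglongrightarrow> m x * exp (- (0 * L x))"
        by (intro AE_I2 tendsto_intros lim)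
      show "AE x in \<mu>. norm (m x * exp (- (Y i * L x))) \<le> 1" for i
        using m1 L0
      proof eventually_elim
        case (elim x)
        have "Y i > 0" using Y by auto
        with elim have "exp (- (Y i * L x)) \<le> 1" by simp
        then have "\<bar>m x\<bar> * exp (- (Y i * L x)) \<le> 1 * 1" using elim by (intro mult_mono) auto
        then show ?case by (simp add: abs_mult)
      qed
    qed auto
  qed
  then show ?thesis unfolding right_analytic_def using hol real by blast
qed

context pos_law begin

lemma right_analytic_mom:
  assumes "a \<ge> 0" "b \<ge> 0" "p \<ge> 0" "q \<ge> 0"
  shows "right_analytic (\<lambda>t. mom \<gamma> \<mu> (a + t) b p q)"
    and "right_analytic (\<lambda>t. mom \<gamma> \<mu> a b (p + t) q)"
    and "right_analytic (\<lambda>t. mom \<gamma> \<mu> a b p (q + t))"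
proof -
  have powr: "y powr (e + t) = y powr e * exp (- (t * (- ln y)))" if "y > 0" for y e t :: real
    using that by (simp add: powr_def exp_add[symmetric] algebra_simps)
  have m: "AE x in \<mu>. \<bar>kern \<gamma> a b p q x\<bar> \<le> 1"
    using kern_le_1[OF \<gamma>_pos assms] kern_nonneg[OF \<gamma>_pos] by (auto simp: abs_of_nonneg)
  have key: "right_analytic f" 
    if y: "y \<in> borel_measurable borel" "\<And>x. x > 0 \<Longrightarrow> 0 < y x \<and> y x < 1"
      and f: "\<And>t. f t = (LINT x|\<mu>. kern \<gamma> a b p q x * exp (- (t * (- ln (y x)))))" for y f
    unfolding f[abs_def]
  proof (rule right_analytic_laplace[OF finite_measure_axioms _ _ m])
    note [measurable] = y(1)
    show "(\<lambda>x. - ln (y x)) \<in> borel_measurable \<mu>" by measurable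
    show "AE x in \<mu>. 0 \<le> - ln (y x)" using AE_pos
    proof eventually_elim
      case (elim x)
      then show ?case using y(2)[of x] by (simp add: ln_le_zero_iff)
    qed
  qed measurable
  show "right_analytic (\<lambda>t. mom \<gamma> \<mu> (a + t) b p q)"
  proof (rule key[of "\<lambda>x. x/(1+x)"])
    fix t show "mom \<gamma> \<mu> (a + t) b p q = (LINT x|\<mu>. kern \<gamma> a b p q x * exp (- (t * (- ln (x/(1+x))))))"
      unfolding mom_def using coords[OF \<gamma>_pos] by (intro Bochner_Integration.integral_cong) (auto simp: kern_def powr)
  qed (use coords[OF \<gamma>_pos] in \<open>auto\<close>)
  show "right_analytic (\<lambda>t. mom \<gamma> \<mu> a b (p + t) q)"
  proof (rule key[of "\<lambda>x. \<gamma>*x/(1+\<gamma>*x)"])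
    fix t show "mom \<gamma> \<mu> a b (p + t) q = (LINT x|\<mu>. kern \<gamma> a b p q x * exp (- (t * (- ln (\<gamma>*x/(1+\<gamma>*x))))))"
      unfolding mom_def using coords[OF \<gamma>_pos] by (intro Bochner_Integration.integral_cong) (auto simp: kern_def powr)
  qed (use coords[OF \<gamma>_pos] in \<open>auto\<close>)
  show "right_analytic (\<lambda>t. mom \<gamma> \<mu> a b p (q + t))"
  proof (rule key[of "\<lambda>x. 1/(1+x)"])
    fix t show "mom \<gamma> \<mu> a b p (q + t) = (LINT x|\<mu>. kern \<gamma> a b p q x * exp (- (t * (- ln (1/(1+x))))))"
      unfolding mom_def using coords[OF \<gamma>_pos] by (intro Bochner_Integration.integral_cong) (auto simp: kern_def powr)
  qed (use coords[OF \<gamma>_pos] in \<open>auto\<close>)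
qed

end

section \<open>Relations at a single exponent\<close>

text \<open>
  In this and the next two lemmas the suffixes denote shifts of the exponent. By $PQ = \gamma AB$, the linear
  relations determine $(1-\gamma) f_{AB}$ and $(1-\gamma) h_{AB}$ from the first shifts. After elimination of the
  shifts by $P$ and $Q$, the claim and the determinant condition become the same polynomial identity. For
  $\gamma = 1$ the moments $f_{AB}$ and $h_{AB}$ are not determined in this way.
\<close>

lemma multiplicative_of_det:
  fixes f h :: real
  assumes "fA + fQ = f" "fB + fP = f" "hA + hP = h" "hB + hQ = h"
    and "fA - fP = (1 - \<gamma>) * fAB" "hA - hQ = (1 - \<gamma>) * hAB" "\<gamma> \<noteq> 1"
    and "fA * fB * (hP * hQ) = fP * fQ * (hA * hB)"
  shows "fAB * f * (hA * hB) = hAB * h * (fA * fB)"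
proof -
  have e: "fQ = f - fA" "fP = f - fB" "hP = h - hA" "hQ = h - hB"
    using assms by auto
  have "(1 - \<gamma>) * (fAB * f * (hA * hB)) = (fA - fP) * f * (hA * hB)"
    by (simp add: assms(5))
  also have "\<dots> = (hA - hQ) * h * (fA * fB)"
    using assms(8) unfolding e by (simp add: algebra_simps)
  also have "\<dots> = (1 - \<gamma>) * (hAB * h * (fA * fB))"
    by (simp add: assms(6))
  finally show ?thesis using assms(7) by simp
qed

text \<open>
  With $r = f/h = k/g$ and the ratios $a, b, p, q$ of the shifted moments, the normalizations of $f$ and of $k$ read
  $a h_A + q h_Q = r h$, $b h_B + p h_P = r h$ and $a g_A + q g_Q = r g$, $b g_B + p g_P = r g$. So the difference of the
  two normalized solutions lies in the kernel of a matrix with determinant $ab - pq$.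
\<close>

lemma dichotomy:
  fixes f g h k :: real
  assumes pos: "h > 0" "hA > 0" "hB > 0" "hP > 0" "hQ > 0"
    and f: "fA + fQ = f" "fB + fP = f" and h: "hA + hP = h" "hB + hQ = h"
    and k: "kA + kQ = k" "kB + kP = k" and g: "gA + gP = g" "gB + gQ = g"
    and prod: "f * g = h * k" "fA * gA = hA * kA" "fB * gB = hB * kB"
       "fP * gP = hP * kP" "fQ * gQ = hQ * kQ"
    and ndet: "fA * fB * (hP * hQ) \<noteq> fP * fQ * (hA * hB)"
  shows "gA * h = hA * g" "gQ * h = hQ * g"
proof -
  define r where "r = f / h"
  define a b p q where "a = fA / hA" and "b = fB / hB" and "p = fP / hP" and "q = fQ / hQ"
  have r: "f = r * h" "k = r * g" and a: "fA = a * hA" "kA = a * gA" and b: "fB = b * hB" "kB = b * gB"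
    and p: "fP = p * hP" "kP = p * gP" and q: "fQ = q * hQ" "kQ = q * gQ"
    using pos prod by (auto simp: r_def a_def b_def p_def q_def field_simps)
  define x y where "x = hA * g - gA * h" and "y = hQ * g - gQ * h"
  have "a * hA + q * hQ = r * h" "a * gA + q * gQ = r * g"
    using f(1) k(1) unfolding r a q by auto
  then have "(a * hA + q * hQ) * g = (a * gA + q * gQ) * h"
    by simp
  then have 1: "a * x + q * y = 0" by (simp add: x_def y_def algebra_simps)
  have e: "hP = h - hA" "hB = h - hQ" "gP = g - gA" "gB = g - gQ" using h g by auto
  have "b * hB + p * hP = r * h" "b * gB + p * gP = r * g"
    using f(2) k(2) unfolding r b p by auto
  then have "(b * hB + p * hP) * g = (b * gB + p * gP) * h"
    by simp
  then have 2: "p * x + b * y = 0" unfolding e by (simp add: x_def y_def algebra_simps)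
  have "a * b - p * q \<noteq> 0"
  proof
    assume "a * b - p * q = 0"
    then have "a * b = p * q" by simp
    then have "(a * b) * (hA * hB * hP * hQ) = (p * q) * (hA * hB * hP * hQ)" by simp
    with ndet show False unfolding a b p q by (simp add: algebra_simps)
  qed
  moreover have "(a * b - p * q) * x = b * (a * x + q * y) - q * (p * x + b * y)"
    "(a * b - p * q) * y = a * (p * x + b * y) - p * (a * x + q * y)"
    by (simp_all add: algebra_simps)
  ultimately have "x = 0" "y = 0" using 1 2 by auto
  then show "gA * h = hA * g" "gQ * h = hQ * g" by (auto simp: x_def y_def)
qed

text \<open>
  This is the compatibility condition of the same linear system when its determinant vanishes.
\<close>

lemma rank_relation:
  fixes f h :: real
  assumes pos: "h > 0" "hA > 0" "hB > 0" "hP > 0" "hQ > 0"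
    and f: "fA + fQ = f" "fB + fP = f" and h: "hA + hP = h" "hB + hQ = h"
    and det: "fA * fB * (hP * hQ) = fP * fQ * (hA * hB)"
  shows "fP / hP * (f / h) + fA / hA * (f / h) = fP / hP * (fQ / hQ) + fA / hA * (fP / hP)"
proof -
  define r where "r = f / h"
  define a b p q where "a = fA / hA" and "b = fB / hB" and "p = fP / hP" and "q = fQ / hQ"
  have r: "f = r * h" and a: "fA = a * hA" and b: "fB = b * hB" 
    and p: "fP = p * hP" and q: "fQ = q * hQ" 
    using pos by (auto simp: r_def a_def b_def p_def q_def field_simps)
  have d: "a * b = p * q" using det pos unfolding a b p q by (simp add: algebra_simps)
  have e: "hP = h - hA" "hB = h - hQ" using h by auto
  have 1: "a * hA + q * hQ = r * h" using f(1) unfolding r a q by auto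
  have 2: "b * hB + p * hP = r * h" using f(2) unfolding r b p by auto
  have "p * (r * h) + a * (r * h) = p * (a * hA + q * hQ) + a * (b * hB + p * hP)"
    using 1 2 by simp
  also have "\<dots> = (a * b) * hB + (p * q) * hQ + a * p * (hA + hP)" by (simp add: algebra_simps)
  also have "\<dots> = (p * q + a * p) * h" using h(2)[symmetric] unfolding d h(1) by (simp add: algebra_simps)
  finally have "(p * r + a * r) * h = (p * q + a * p) * h" by (simp add: algebra_simps)
  then show ?thesis using pos unfolding r_def[symmetric] a_def[symmetric] b_def[symmetric] p_def[symmetric] q_def[symmetric] by simp
qed

section \<open>Rigidity of the ratio on the lattice\<close>

lemma cross_chain:
  fixes x :: real
  shows "x * n = y * s \<Longrightarrow> x * t = y * z \<Longrightarrow> y * s * t = y * (z * n)"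
  by algebra

text \<open>
  Homogeneous coordinates $(l : m : n : s)$ for the four ratios of $T$ at a lattice point. For
  moments of the pair of laws $\mathrm{GB}_{II}(\pm\lambda, a, b)$ they are, at exponent zero,
  $(b + \lambda : b - \lambda : a + \lambda : a - \lambda)$.
\<close>

definition rep :: "(nat \<Rightarrow> nat \<Rightarrow> nat \<Rightarrow> nat \<Rightarrow> real) \<Rightarrow> nat \<Rightarrow> nat \<Rightarrow> nat \<Rightarrow> nat \<Rightarrow> real \<Rightarrow> real \<Rightarrow> real \<Rightarrow> real \<Rightarrow> bool" where
  "rep T a b p q l m n s \<longleftrightarrow> l > 0 \<and> m > 0 \<and> n > 0 \<and> s > 0 \<and> l + s = m + n \<and>
     T (Suc a) b p q * m = T a b p q * l \<and> T a b (Suc p) q * n = T a b p q * l \<and>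
     T a (Suc b) p q * n = T a b p q * s \<and> T a b p (Suc q) * m = T a b p q * s"

locale lattice_ratio =
  fixes T :: "nat \<Rightarrow> nat \<Rightarrow> nat \<Rightarrow> nat \<Rightarrow> real"
  assumes pos: "T a b p q > 0"
    and c0: "T (Suc a) (Suc b) p q = T a b (Suc p) (Suc q)"
    and c1: "T (Suc a) b p q * T a (Suc b) p q = T a b (Suc p) q * T a b p (Suc q)"
    and c2: "T a b (Suc p) q * T a b p q + T (Suc a) b p q * T a b p q =
       T a b (Suc p) q * T a b p (Suc q) + T (Suc a) b p q * T a b (Suc p) q"
    and c3: "T (Suc a) (Suc b) p q * T a b p q = T (Suc a) b p q * T a (Suc b) p q"
begin

lemma rep_scale: "c > 0 \<Longrightarrow> rep T a b p q l m n s \<Longrightarrow> rep T a b p q (c * l) (c * m) (c * n) (c * s)"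
  unfolding rep_def by (auto simp: mult.left_commute simp flip: distrib_left)

lemma rep_ex: "\<exists>l m n s. rep T a b p q l m n s"
proof -
  let ?t = "T a b p q" and ?A = "T (Suc a) b p q" and ?P = "T a b (Suc p) q"
    and ?B = "T a (Suc b) p q" and ?Q = "T a b p (Suc q)"
  have p: "?t > 0" "?A > 0" "?P > 0" "?B > 0" "?Q > 0" by (auto simp: pos)
  have c1': "?Q = ?A * ?B / ?P" using c1[of a b p q] p by (simp add: field_simps)
  have "1 + ?B / ?P = ?t / ?A + ?t / ?P"
    using c2[of a b p q] p unfolding c1' by (simp add: field_simps)
  then have "rep T a b p q 1 (?t / ?A) (?t / ?P) (?B / ?P)"
    using p unfolding rep_def c1' by (simp add: field_simps)
  then show ?thesis by blast
qed

text \<open>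
  The increment of the coordinates when the exponent of $A$ or of $P$ is raised. The formula is symmetric under
  the exchange of $A, m$ with $P, n$, which is why both shifts have the same increment.
\<close>

definition eps where "eps a b p q l m n = m * n * T (Suc a) b (Suc p) q / (T a b p q * l) - l"

text \<open>
  The multiplicative relations make the ratio $\tau_Q / \tau = s/m$ the same at $w$ and at $w + P$, so
  coordinates at $w + P$ can be scaled to have the old $m$ and $s$. Then $l + s = m + n$ forces $l$ and $n$ to move by the
  same amount, which is read off from $\tau_{AP}$. The other three directions are
  analogous.
\<close>

lemma rep_P:
  assumes "rep T a b p q l m n s"
  defines "e \<equiv> eps a b p q l m n"
  shows "rep T a b (Suc p) q (l + e) m (n + e) s"
proof -
  have r: "l > 0" "m > 0" "n > 0" "s > 0" "l + s = m + n"
     "T a b (Suc p) q * n = T a b p q * l" "T a b p (Suc q) * m = T a b p q * s"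
     "T (Suc a) b p q * m = T a b p q * l"
    using assms(1) by (auto simp: rep_def)
  let ?t = "T a b p q"
  have t: "?t > 0" "T a b (Suc p) q > 0" by (auto simp: pos)
  obtain l' m' n' s' where rr: "rep T a b (Suc p) q l' m' n' s'" using rep_ex by blast
  then have "m' > 0" by (simp add: rep_def)
  with rep_scale[OF _ rr, of "m / m'"] r obtain l2 n2 s2
    where r2: "rep T a b (Suc p) q l2 m n2 s2" by auto
  have i: "T a b (Suc p) (Suc q) * m = T a b (Suc p) q * s2" "l2 + s2 = m + n2"
      "T (Suc a) b (Suc p) q * m = T a b (Suc p) q * l2"
    using r2 by (auto simp: rep_def)
  have "T a b (Suc p) (Suc q) * ?t = T a b (Suc p) q * T a b p (Suc q)"
    using c3[of a b p q] c0[of a b p q] c1[of a b p q] by simp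
  then have "T a b (Suc p) q * s2 * ?t = T a b (Suc p) q * (T a b p (Suc q) * m)"
    by (rule cross_chain[OF i(1)])
  then have s2: "s2 = s" using t r(7) by simp
  have "m * n * T (Suc a) b (Suc p) q = (T a b (Suc p) q * n) * l2"
    using i(3) by (simp add: algebra_simps)
  then have "e = l2 - l" using t r unfolding e_def eps_def by simp
  then have "l2 = l + e" "n2 = n + e" using i(2) r(5) s2 by auto
  with r2 s2 show ?thesis by simp
qed

lemma rep_A:
  assumes "rep T a b p q l m n s"
  defines "e \<equiv> eps a b p q l m n"
  shows "rep T (Suc a) b p q (l + e) (m + e) n s"
proof -
  have r: "l > 0" "m > 0" "n > 0" "s > 0" "l + s = m + n"
     "T a b (Suc p) q * n = T a b p q * l" "T a (Suc b) p q * n = T a b p q * s"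
     "T (Suc a) b p q * m = T a b p q * l"
    using assms(1) by (auto simp: rep_def)
  let ?t = "T a b p q"
  have t: "?t > 0" "T (Suc a) b p q > 0" by (auto simp: pos)
  obtain l' m' n' s' where rr: "rep T (Suc a) b p q l' m' n' s'" using rep_ex by blast
  then have "n' > 0" by (simp add: rep_def)
  with rep_scale[OF _ rr, of "n / n'"] r obtain l2 m2 s2
    where r2: "rep T (Suc a) b p q l2 m2 n s2" by auto
  have i: "T (Suc a) (Suc b) p q * n = T (Suc a) b p q * s2" "l2 + s2 = m2 + n"
      "T (Suc a) b (Suc p) q * n = T (Suc a) b p q * l2"
    using r2 by (auto simp: rep_def)
  have "T (Suc a) b p q * s2 * ?t = T (Suc a) b p q * (T a (Suc b) p q * n)"
    by (rule cross_chain[OF i(1) c3])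
  then have s2: "s2 = s" using t r(7) by simp
  have "m * n * T (Suc a) b (Suc p) q = (T (Suc a) b p q * m) * l2"
    using i(3) by (simp add: algebra_simps)
  then have "e = l2 - l" using t r unfolding e_def eps_def by simp
  then have "l2 = l + e" "m2 = m + e" using i(2) r(5) s2 by auto
  with r2 s2 show ?thesis by simp
qed

text \<open>
  Here $l$ and $n$ are kept; the increment agrees with the one in direction $A$ because both lead to $w + A + Q$.
\<close>

lemma rep_Q:
  assumes "rep T a b p q l m n s"
  defines "e \<equiv> eps a b p q l m n"
  shows "rep T a b p (Suc q) l (m + e) n (s + e)"
proof -
  have r: "l > 0" "m > 0" "n > 0" "s > 0" "l + s = m + n"
     "T a b (Suc p) q * n = T a b p q * l" "T a b p (Suc q) * m = T a b p q * s"
     "T (Suc a) b p q * m = T a b p q * l"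
    using assms(1) by (auto simp: rep_def)
  let ?t = "T a b p q"
  have t: "?t > 0" "T a b p (Suc q) > 0" "T (Suc a) b p (Suc q) > 0" by (auto simp: pos)
  obtain l' m' n' s' where rr: "rep T a b p (Suc q) l' m' n' s'" using rep_ex by blast
  then have "n' > 0" by (simp add: rep_def)
  with rep_scale[OF _ rr, of "n / n'"] r obtain l2 m2 s2
    where r2: "rep T a b p (Suc q) l2 m2 n s2" by auto
  have i: "T a b (Suc p) (Suc q) * n = T a b p (Suc q) * l2" "l2 + s2 = m2 + n"
      "T (Suc a) b p (Suc q) * m2 = T a b p (Suc q) * l2"
    using r2 by (auto simp: rep_def)
  have "T a b (Suc p) (Suc q) * ?t = T a b p (Suc q) * T a b (Suc p) q"
    using c3[of a b p q] c0[of a b p q] c1[of a b p q] by (simp add: mult.commute)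
  then have "T a b p (Suc q) * l2 * ?t = T a b p (Suc q) * (T a b (Suc p) q * n)"
    by (rule cross_chain[OF i(1)])
  then have l2: "l2 = l" using t r(6) by simp
  have "T (Suc a) b p (Suc q) * (m + e) = T (Suc a) b p q * s"
    using rep_A[OF assms(1)] unfolding e_def by (simp add: rep_def)
  then have "T (Suc a) b p (Suc q) * (m + e) * m = ?t * l * s"
    using r(8) by (simp add: mult.assoc mult.left_commute)
  also have "\<dots> = T (Suc a) b p (Suc q) * m2 * m"
    using r(7) i(3) unfolding l2 by (simp add: algebra_simps)
  finally have "m2 = m + e" using t r by simp
  moreover from this have "s2 = s + e" using i(2) r(5) l2 by auto
  ultimately show ?thesis using r2 l2 by simp
qed

text \<open>
  Here $l$ and $m$ are kept; the increment agrees with the one in direction $P$ because both lead to $w + P + B$.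
\<close>

lemma rep_B:
  assumes "rep T a b p q l m n s"
  defines "e \<equiv> eps a b p q l m n"
  shows "rep T a (Suc b) p q l m (n + e) (s + e)"
proof -
  have r: "l > 0" "m > 0" "n > 0" "s > 0" "l + s = m + n"
     "T a b (Suc p) q * n = T a b p q * l" "T a (Suc b) p q * n = T a b p q * s"
     "T (Suc a) b p q * m = T a b p q * l"
    using assms(1) by (auto simp: rep_def)
  let ?t = "T a b p q"
  have t: "?t > 0" "T a (Suc b) p q > 0" "T a (Suc b) (Suc p) q > 0" by (auto simp: pos)
  obtain l' m' n' s' where rr: "rep T a (Suc b) p q l' m' n' s'" using rep_ex by blast
  then have "m' > 0" by (simp add: rep_def)
  with rep_scale[OF _ rr, of "m / m'"] r obtain l2 n2 s2
    where r2: "rep T a (Suc b) p q l2 m n2 s2" by auto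
  have i: "T (Suc a) (Suc b) p q * m = T a (Suc b) p q * l2" "l2 + s2 = m + n2"
      "T a (Suc b) (Suc p) q * n2 = T a (Suc b) p q * l2"
    using r2 by (auto simp: rep_def)
  have "T a (Suc b) p q * l2 * ?t = T a (Suc b) p q * (T (Suc a) b p q * m)"
    using cross_chain[OF i(1), of ?t "T (Suc a) b p q"] c3[of a b p q] by (simp add: mult.commute)
  then have l2: "l2 = l" using t r(8) by simp
  have "T a (Suc b) (Suc p) q * (n + e) = T a b (Suc p) q * s"
    using rep_P[OF assms(1)] unfolding e_def by (simp add: rep_def)
  then have "T a (Suc b) (Suc p) q * (n + e) * n = ?t * l * s"
    using r(6) by (simp add: mult.assoc mult.left_commute)
  also have "\<dots> = T a (Suc b) (Suc p) q * n2 * n"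
    using r(7) i(3) unfolding l2 by (simp add: algebra_simps)
  finally have "n2 = n + e" using t r by simp
  moreover from this have "s2 = s + e" using i(2) r(5) l2 by auto
  ultimately show ?thesis using r2 l2 by simp
qed

lemma rep_unique:
  assumes "rep T a b p q l m n s" "rep T a b p q l' m' n' s'"
  shows "l * m' = l' * m" "l * n' = l' * n" "l * s' = l' * s"
proof -
  have t: "T a b p q > 0" "T (Suc a) b p q > 0" "T a b (Suc p) q > 0" "T a (Suc b) p q > 0"  by (auto simp: pos)
  have r: "T (Suc a) b p q * m = T a b p q * l" "T a b (Suc p) q * n = T a b p q * l"
    "T (Suc a) b p q * m' = T a b p q * l'" "T a b (Suc p) q * n' = T a b p q * l'"
    "l + s = m + n" "l' + s' = m' + n'"
    using assms by (auto simp: rep_def)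
  have "T a b p q * (l * m') = T a b p q * (l' * m)" "T a b p q * (l * n') = T a b p q * (l' * n)"
    using cross_chain[of "T (Suc a) b p q" m "T a b p q" l m' l'] cross_chain[of "T a b (Suc p) q" n "T a b p q" l n' l'] r
    by (simp_all add: mult.assoc)
  then show 1: "l * m' = l' * m" and 2: "l * n' = l' * n" using t by auto
  have "s = m + n - l" "s' = m' + n' - l'" using r(5,6) by auto
  then show "l * s' = l' * s" using 1 2 by algebra
qed


text \<open>
  Two consecutive steps in different directions can be taken in either order, and the two resulting coordinate
  vectors are proportional. The pairs of directions used here leave one coordinate unchanged in both steps, so the two
  vectors are equal, and the increment does not change from point to point.
\<close>

lemma rep_affine:
  assumes "rep T 0 0 0 0 l m n s"
  defines "e \<equiv> eps 0 0 0 0 l m n"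
  shows "rep T a b p q (l + e * (a + p)) (m + e * (a + q)) (n + e * (b + p)) (s + e * (b + q))"
proof -
  define good where "good a b p q l m n s \<longleftrightarrow> rep T a b p q l m n s \<and> eps a b p q l m n = e" 
    for a b p q l m n s
  have A: "good (Suc a) b p q (l + e) (m + e) n s" if "good a b p q l m n s" for a b p q l m n s
  proof -
    have r: "rep T a b p q l m n s" "eps a b p q l m n = e" using that by (auto simp: good_def)
    note rA = rep_A[OF r(1), unfolded r(2)] and rP = rep_P[OF r(1), unfolded r(2)]
    let ?e = "eps (Suc a) b p q (l + e) (m + e) n" and ?f = "eps a b (Suc p) q (l + e) m (n + e)"
    have "rep T (Suc a) b (Suc p) q (l + e + ?e) (m + e) (n + ?e) s"
         "rep T (Suc a) b (Suc p) q (l + e + ?f) (m + ?f) (n + e) s"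
      using rep_P[OF rA] rep_A[OF rP] by auto
    from rep_unique[OF this] this have "?e = ?f" "(l + e + ?e) * (n + e) = (l + e + ?e) * (n + ?e)" "l + e + ?e > 0"
      by (auto simp: rep_def)
    then have "?e = e" by simp
    then show ?thesis using rA by (simp add: good_def)
  qed
  have P: "good a b (Suc p) q (l + e) m (n + e) s" if "good a b p q l m n s" for a b p q l m n s
  proof -
    have r: "rep T a b p q l m n s" "eps a b p q l m n = e" using that by (auto simp: good_def)
    note rA = rep_A[OF r(1), unfolded r(2)] and rP = rep_P[OF r(1), unfolded r(2)]
    let ?e = "eps (Suc a) b p q (l + e) (m + e) n" and ?f = "eps a b (Suc p) q (l + e) m (n + e)"
    have "?e = e" using A[OF that] by (simp add: good_def)
    then have "rep T (Suc a) b (Suc p) q (l + e + e) (m + e) (n + e) s"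
         "rep T (Suc a) b (Suc p) q (l + e + ?f) (m + ?f) (n + e) s"
      using rep_P[OF rA] rep_A[OF rP] by auto
    from rep_unique[OF this] this have "?f = e"
      by (auto simp: rep_def)
    then show ?thesis using rP by (simp add: good_def)
  qed
  have Q: "good a b p (Suc q) l (m + e) n (s + e)" if "good a b p q l m n s" for a b p q l m n s
  proof -
    have r: "rep T a b p q l m n s" "eps a b p q l m n = e" using that by (auto simp: good_def)
    note rA = rep_A[OF r(1), unfolded r(2)] and rQ = rep_Q[OF r(1), unfolded r(2)]
    let ?e = "eps (Suc a) b p q (l + e) (m + e) n" and ?f = "eps a b p (Suc q) l (m + e) n"
    have "?e = e" using A[OF that] by (simp add: good_def)
    then have "rep T (Suc a) b p (Suc q) (l + e) (m + e + e) n (s + e)"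
         "rep T (Suc a) b p (Suc q) (l + ?f) (m + e + ?f) n (s + e)"
      using rep_Q[OF rA] rep_A[OF rQ] by auto
    from rep_unique[OF this] this have "?f = e"
      by (auto simp: rep_def)
    then show ?thesis using rQ by (simp add: good_def)
  qed
  have B: "good a (Suc b) p q l m (n + e) (s + e)" if "good a b p q l m n s" for a b p q l m n s
  proof -
    have r: "rep T a b p q l m n s" "eps a b p q l m n = e" using that by (auto simp: good_def)
    note rP = rep_P[OF r(1), unfolded r(2)] and rB = rep_B[OF r(1), unfolded r(2)]
    let ?e = "eps a b (Suc p) q (l + e) m (n + e)" and ?f = "eps a (Suc b) p q l m (n + e)"
    have "?e = e" using P[OF that] by (simp add: good_def)
    then have "rep T a (Suc b) (Suc p) q (l + e) m (n + e + e) (s + e)"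
         "rep T a (Suc b) (Suc p) q (l + ?f) m (n + e + ?f) (s + e)"
      using rep_B[OF rP] rep_P[OF rB] by auto
    from rep_unique[OF this] this have "?f = e"
      by (auto simp: rep_def)
    then show ?thesis using rB by (simp add: good_def)
  qed
  have "good 0 0 0 0 l m n s" using assms by (simp add: good_def)
  then have "good a 0 0 0 (l + e * a) (m + e * a) n s"
  proof (induction a)
    case (Suc a)
    from A[OF Suc.IH[OF Suc.prems]] show ?case by (simp add: algebra_simps)
  qed simp
  then have "good a b 0 0 (l + e * a) (m + e * a) (n + e * b) (s + e * b)"
  proof (induction b)
    case (Suc b)
    from B[OF Suc.IH[OF Suc.prems]] show ?case by (simp add: algebra_simps)
  qed simp
  then have "good a b p 0 (l + e * (a + p)) (m + e * a) (n + e * (b + p)) (s + e * b)"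
  proof (induction p)
    case (Suc p)
    from P[OF Suc.IH[OF Suc.prems]] show ?case by (simp add: algebra_simps)
  qed simp
  then have "good a b p q (l + e * (a + p)) (m + e * (a + q)) (n + e * (b + p)) (s + e * (b + q))"
  proof (induction q)
    case (Suc q)
    from Q[OF Suc.IH[OF Suc.prems]] show ?case by (simp add: algebra_simps)
  qed simp
  then show ?thesis by (simp add: good_def)
qed

text \<open>
  A negative slope would make the coordinate $l$ negative far out in direction $A$.
\<close>

lemma affine_parameters:
  obtains l m n s e :: real where "e \<ge> 0"
    "\<And>a b p q. rep T a b p q (l + e * (a + p)) (m + e * (a + q)) (n + e * (b + p)) (s + e * (b + q))"
proof -
  obtain l m n s where "rep T 0 0 0 0 l m n s" using rep_ex by blast
  from rep_affine[OF this] obtain e :: real where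
    r: "\<And>a b p q. rep T a b p q (l + e * (a + p)) (m + e * (a + q)) (n + e * (b + p)) (s + e * (b + q))"
    by blast
  have "e \<ge> 0"
  proof (rule ccontr)
    assume "\<not> e \<ge> 0"
    then obtain N :: nat where "real N * (- e) > l"
      using reals_Archimedean3[of "- e"] by auto
    moreover have "l + e * N > 0" using r[of N 0 0 0] by (simp add: rep_def)
    ultimately show False by (simp add: algebra_simps)
  qed
  with r show thesis using that by blast
qed

end

section \<open>Stein identities characterize the law\<close>

text \<open>
  For $z = \gamma x/(1+\gamma x)$ one has $x \frac{d}{dx} = z(1-z)\frac{d}{dz}$, so the moment identities in the hypothesis
  with exponent $k \ge 1$ are Stein identities for $\psi(z) = z^k$. A primitive of a polynomial approximating $\psi'$ uniformly approximates
  $\psi$ as well, because both vanish at $0$. The integrand enters as a function $\Phi$ of $x$, because $D$ and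
  $\psi$ are only controlled on the unit interval.
\<close>

lemma Stein_identity_C1:
  fixes \<mu> :: "real measure" and \<gamma> l m n :: real
  assumes "prob_space \<mu>" and sets: "sets \<mu> = sets borel" and pos: "AE x in \<mu>. x > 0" and g: "\<gamma> > 0"
    and hyp: "\<And>k::nat. (LINT x|\<mu>. (\<gamma>*x/(1+\<gamma>*x))^k * ((l + k) - m * (x/(1+x)) - (n + k) * (\<gamma>*x/(1+\<gamma>*x)))) = 0"
    and deriv: "\<And>u. u \<in> {0..1} \<Longrightarrow> (\<psi> has_real_derivative D u) (at u within {0..1})"
    and cont: "continuous_on {0..1} D" and \<psi>0: "\<psi> 0 = 0"
    and meas: "\<Phi> \<in> borel_measurable borel"
    and \<Phi>: "\<And>x z. x > 0 \<Longrightarrow> z = \<gamma>*x/(1+\<gamma>*x) \<Longrightarrow> \<Phi> x = z * (1-z) * D z + (l - m * (x/(1+x)) - n * z) * \<psi> z"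
  shows "(LINT x|\<mu>. \<Phi> x) = 0"
proof -
  interpret prob_space \<mu> by fact
  note [measurable_cong] = sets
  note [measurable] = meas
  define z where "z x = \<gamma>*x/(1+\<gamma>*x)" for x
  define \<eta> where "\<eta> x = l - m * (x/(1+x)) - n * z x" for x
  have [measurable]: "z \<in> borel_measurable borel" unfolding z_def[abs_def] by measurable
  have [measurable]: "\<eta> \<in> borel_measurable borel" unfolding \<eta>_def[abs_def] by measurable
  define C where "C = \<bar>l\<bar> + \<bar>m\<bar> + \<bar>n\<bar>"
  have z: "z x \<in> {0..1}" if "x > 0" for x
    using that g by (simp add: z_def divide_simps add_pos_pos)
  have a: "x/(1+x) \<in> {0..1}" if "x > 0" for x :: real
    using that by (simp add: divide_simps)
  have \<eta>: "\<bar>\<eta> x\<bar> \<le> C" if "x > 0" for x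
  proof -
    have "\<bar>c * y\<bar> \<le> \<bar>c\<bar>" if "y \<in> {0..1}" for c y :: real
      using that by (auto simp: abs_mult intro: mult_left_le)
    from this[OF a[OF that], of m] this[OF z[OF that], of n]
    have "\<bar>m * (x/(1+x))\<bar> \<le> \<bar>m\<bar>" "\<bar>n * z x\<bar> \<le> \<bar>n\<bar>" .
    then show ?thesis unfolding \<eta>_def C_def by linarith
  qed
  have C: "C \<ge> 0" by (simp add: C_def)
  have bound: "\<bar>LINT x|\<mu>. \<Phi> x\<bar> \<le> e * (1 + C)" if e: "e > 0" for e
  proof -
    obtain P where "real_polynomial_function P" and P: "\<And>u. u \<in> {0..1} \<Longrightarrow> \<bar>D u - P u\<bar> < e"
      using Stone_Weierstrass_real_polynomial_function[OF compact_Icc cont e] by blast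
    then obtain c N where Pc: "P = (\<lambda>u. \<Sum>i\<le>N. c i * u^i)"
      unfolding real_polynomial_function_iff_sum by blast
    define R where "R u = (\<Sum>i\<le>N. c i / (i + 1) * u^(i+1))" for u :: real
    have R: "(R has_real_derivative P u) (at u within {0..1})" for u
      unfolding R_def[abs_def] Pc
    proof (rule DERIV_sum)
      fix i
      show "((\<lambda>u. c i / (i + 1) * u^(i+1)) has_real_derivative c i * u^i) (at u within {0..1})"
        using DERIV_cmult[OF has_field_derivative_at_within[OF DERIV_pow[of "i+1" u]], of "c i / (i + 1)" "{0..1}"]
        by simp
    qed
    have psiR: "\<bar>\<psi> u - R u\<bar> \<le> e" if u: "u \<in> {0..1}" for u
    proof -
      have "norm ((\<psi> u - R u) - (\<psi> 0 - R 0)) \<le> e * norm (u - 0)"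
      proof (rule field_differentiable_bound[of "{0..1}" "\<lambda>u. \<psi> u - R u" "\<lambda>u. D u - P u"])
        fix v :: real assume v: "v \<in> {0..1}"
        then show "((\<lambda>u. \<psi> u - R u) has_field_derivative D v - P v) (at v within {0..1})"
          by (intro DERIV_diff deriv R)
        show "norm (D v - P v) \<le> e" using P[OF v] by simp
      qed (use u in auto)
      also have "e * norm (u - 0) \<le> e * 1" using u e by (intro mult_left_mono) auto
      finally show ?thesis by (simp add: \<psi>0 R_def)
    qed
    define h where "h k x = z x ^ k * ((l + real k) - m * (x/(1+x)) - (n + real k) * z x)" for k x
    have [measurable]: "h k \<in> borel_measurable borel" for k unfolding h_def[abs_def] by measurable
    define \<Phi>P where "\<Phi>P x = (\<Sum>i\<le>N. c i / (i + 1) * h (i + 1) x)" for x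
    have h_int: "integrable \<mu> (h k)" for k
    proof (rule integrable_const_bound)
      show "AE x in \<mu>. norm (h k x) \<le> (C + k) + k"
        using pos
      proof eventually_elim
        case (elim x)
        have "h k x = z x ^ k * (\<eta> x + k - k * z x)" by (simp add: h_def \<eta>_def algebra_simps)
        moreover have "\<bar>\<eta> x + k - k * z x\<bar> \<le> (C + k) + k"
        proof -
          have "0 \<le> k * z x" "k * z x \<le> real k * 1" using z[OF elim] by (auto simp del: mult_1_right mult.right_neutral intro: mult_left_mono)
          then show ?thesis using \<eta>[OF elim] by linarith
        qed
        moreover have "\<bar>z x ^ k\<bar> \<le> 1" using z[OF elim] by (simp add: power_le_one)
        ultimately have "\<bar>h k x\<bar> \<le> 1 * ((C + k) + k)"
          unfolding abs_mult by (simp only: abs_mult) (intro mult_mono, auto)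
        then show ?case by simp
      qed
    qed measurable
    have "(LINT x|\<mu>. \<Phi>P x) = (\<Sum>i\<le>N. c i / (i + 1) * (LINT x|\<mu>. h (i + 1) x))"
      unfolding \<Phi>P_def using h_int by simp
    also have "\<dots> = 0"
    proof (intro sum.neutral ballI)
      fix i
      show "c i / (i + 1) * (LINT x|\<mu>. h (i + 1) x) = 0"
        using hyp[of "i + 1", folded z_def] unfolding h_def by simp
    qed
    finally have P0: "(LINT x|\<mu>. \<Phi>P x) = 0" .
    have P_int: "integrable \<mu> \<Phi>P" unfolding \<Phi>P_def[abs_def] using h_int by simp
    have P_eq: "\<Phi>P x = z x * (1 - z x) * P (z x) + \<eta> x * R (z x)" for x
    proof -
      have "c i / (i + 1) * h (i + 1) x = z x * (1 - z x) * (c i * z x ^ i) + \<eta> x * (c i / (i + 1) * z x ^ (i + 1))" for i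
        by (simp add: h_def \<eta>_def field_simps)
      then show ?thesis unfolding \<Phi>P_def Pc R_def sum_distrib_left by (simp add: sum.distrib)
    qed
    have diff: "AE x in \<mu>. norm (\<Phi> x - \<Phi>P x) \<le> e * (1 + C)"
      using pos
    proof eventually_elim
      case (elim x)
      have zx: "z x \<in> {0..1}" by (rule z[OF elim])
      have "\<Phi> x - \<Phi>P x = z x * (1 - z x) * (D (z x) - P (z x)) + \<eta> x * (\<psi> (z x) - R (z x))"
        unfolding P_eq \<Phi>[OF elim z_def] \<eta>_def[symmetric] by (simp add: algebra_simps)
      also have "\<bar>\<dots>\<bar> \<le> \<bar>z x * (1 - z x)\<bar> * \<bar>D (z x) - P (z x)\<bar> + \<bar>\<eta> x\<bar> * \<bar>\<psi> (z x) - R (z x)\<bar>"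
        by (simp add: abs_mult[symmetric] abs_triangle_ineq)
      also have "\<dots> \<le> 1 * e + C * e"
        using P[OF zx] psiR[OF zx] \<eta>[OF elim] zx C
        by (intro add_mono mult_mono) (auto simp: mult_le_one abs_mult)
      finally show ?case by (simp add: algebra_simps)
    qed
    have d_int: "integrable \<mu> (\<lambda>x. \<Phi> x - \<Phi>P x)"
      by (rule integrable_const_bound[OF diff]) (use P_int in measurable)
    have "integrable \<mu> (\<lambda>x. (\<Phi> x - \<Phi>P x) + \<Phi>P x)" by (rule Bochner_Integration.integrable_add[OF d_int P_int])
    then have f_int: "integrable \<mu> \<Phi>" by simp
    have "(LINT x|\<mu>. \<Phi> x) = (LINT x|\<mu>. \<Phi> x - \<Phi>P x)"
      using f_int P_int P0 by simp
    also have "\<bar>\<dots>\<bar> \<le> (LINT x|\<mu>. norm (\<Phi> x - \<Phi>P x))"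
      using integral_norm_bound[of \<mu> "\<lambda>x. \<Phi> x - \<Phi>P x"] by simp
    also have "\<dots> \<le> (LINT x|\<mu>. e * (1 + C))"
      using d_int diff by (intro integral_mono_AE) auto
    finally show ?thesis by (simp add: prob_space)
  qed
  have "\<bar>LINT x|\<mu>. \<Phi> x\<bar> \<le> 0"
  proof (rule field_le_epsilon)
    fix e :: real assume "e > 0"
    then show "\<bar>LINT x|\<mu>. \<Phi> x\<bar> \<le> 0 + e"
      using bound[of "e / (1 + C)"] C by simp
  qed
  then show ?thesis by simp
qed

lemma integral_eq_0_on:
  fixes f :: "real \<Rightarrow> real"
  assumes "\<And>x. x \<in> S \<Longrightarrow> f x = 0"
  shows "integral S f = 0"
  using integral_cong[of S f "\<lambda>_. 0"] assms by simp

text \<open>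
  Let $w = x^l (1+\gamma x)^{-n} (1+x)^{-m}$, so that $x w' = \eta w$ for the Stein coefficient $\eta$. Then
  $\Psi(x) = \frac{1}{w(x)} \int_0^x \varphi(t) w(t) \frac{dt}{t}$ solves $x \Psi' + \eta \Psi = \varphi$. When the
  integral over the whole support vanishes, $\Psi$ has compact support in the open half-line. This makes it
  continuously differentiable as a function of $z = \gamma x/(1+\gamma x)$ up to both ends of the unit interval.
\<close>

lemma annihilates_test_functions:
  fixes \<mu> :: "real measure" and \<gamma> l m n :: real
  assumes mu: "prob_space \<mu>" "sets \<mu> = sets borel" "AE x in \<mu>. x > 0" and g: "\<gamma> > 0"
    and hyp: "\<And>k::nat. (LINT x|\<mu>. (\<gamma>*x/(1+\<gamma>*x))^k * ((l + k) - m * (x/(1+x)) - (n + k) * (\<gamma>*x/(1+\<gamma>*x)))) = 0"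
    and cd: "0 < c" "c < d" and cont: "continuous_on UNIV \<phi>" and supp: "\<And>x. x \<notin> {c..d} \<Longrightarrow> \<phi> x = 0"
    and zero: "integral {0..d} (\<lambda>x. \<phi> x * (x powr l * (1+\<gamma>*x) powr (-n) * (1+x) powr (-m)) / x) = 0"
  shows "(LINT x|\<mu>. \<phi> x) = 0"
proof -
  define w where "w x = x powr l * (1+\<gamma>*x) powr (-n) * (1+x) powr (-m)" for x
  define f where "f x = \<phi> x * w x / x" for x
  define \<eta> where "\<eta> x = l - m * (x/(1+x)) - n * (\<gamma>*x/(1+\<gamma>*x))" for x
  have gp: "1 + \<gamma> * x > 0" if "x > 0" for x using that g by (simp add: add_pos_pos)
  have w0: "w x > 0" if "x > 0" for x
    using that gp[OF that] by (simp add: w_def)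
  have w': "(w has_real_derivative w x * \<eta> x / x) (at x)" if x: "x > 0" for x
  proof -
    have "((\<lambda>x. x powr l) has_real_derivative x powr l * (l / x)) (at x)"
      using x by (auto intro!: derivative_eq_intros simp: powr_diff)
    moreover have "((\<lambda>x. (1+\<gamma>*x) powr (-n)) has_real_derivative (1+\<gamma>*x) powr (-n) * (-n * \<gamma> / (1+\<gamma>*x))) (at x)"
      using gp[OF x] by (auto intro!: derivative_eq_intros simp: powr_diff)
    moreover have "((\<lambda>x. (1+x) powr (-m)) has_real_derivative (1+x) powr (-m) * (-m / (1+x))) (at x)"
      using x by (auto intro!: derivative_eq_intros simp: powr_diff)
    ultimately have "(w has_real_derivative
        (x powr l * (l / x) * (1+\<gamma>*x) powr (-n) + (1+\<gamma>*x) powr (-n) * (-n * \<gamma> / (1+\<gamma>*x)) * x powr l) * (1+x) powr (-m)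
         + (1+x) powr (-m) * (-m / (1+x)) * (x powr l * (1+\<gamma>*x) powr (-n))) (at x)"
      unfolding w_def[abs_def] by (intro DERIV_mult)
    also have "(x powr l * (l / x) * (1+\<gamma>*x) powr (-n) + (1+\<gamma>*x) powr (-n) * (-n * \<gamma> / (1+\<gamma>*x)) * x powr l) * (1+x) powr (-m)
         + (1+x) powr (-m) * (-m / (1+x)) * (x powr l * (1+\<gamma>*x) powr (-n))
        = w x * (l / x - n * \<gamma> / (1+\<gamma>*x) - m / (1+x))"
      by (simp add: w_def algebra_simps)
    also have "\<dots> = w x * \<eta> x / x"
      using x gp[OF x] by (simp add: \<eta>_def divide_simps) (simp add: algebra_simps)
    finally show ?thesis .
  qed
  have w_cont: "isCont w x" if "x > 0" for x using w'[OF that] DERIV_isCont by blast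
  have phi_cont: "isCont \<phi> x" for x using cont by (simp add: continuous_on_eq_continuous_at)
  have f0: "f x = 0" if "x < c" for x using supp that by (simp add: f_def)
  have f_cont: "isCont f x" for x
  proof (cases "x > 0")
    case True
    then show ?thesis unfolding f_def[abs_def] by (intro continuous_intros phi_cont w_cont) auto
  next
    case False
    then have "eventually (\<lambda>y. f y = 0) (nhds x)"
      using f0 eventually_nhds_in_open[of "{..<c}" x] cd by (auto elim!: eventually_mono)
    then show ?thesis by (subst isCont_cong[of f "\<lambda>_. 0"]) auto
  qed
  define G where "G x = integral {0..x} f" for x
  have G': "(G has_real_derivative f x) (at x)" if "x > 0" for x
  proof -
    have "((\<lambda>x. integral {0..x} f) has_real_derivative f x) (at x within {0..x+1})"
      using that f_cont by (intro integral_has_real_derivative continuous_at_imp_continuous_on) auto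
    moreover have "at x within {0..x+1} = at x"
      using that by (intro at_within_interior) auto
    ultimately show ?thesis by (simp add: G_def[abs_def])
  qed
  have G_low: "G x = 0" if "x < c" for x
    unfolding G_def using that f0 by (intro integral_eq_0_on) auto
  have G_high: "G x = 0" if "x > d" for x
  proof -
    have "integral {0..d} f + integral {d..x} f = integral {0..x} f"
      using that cd f_cont by (intro Henstock_Kurzweil_Integration.integral_combine integrable_continuous_interval continuous_at_imp_continuous_on) auto
    moreover have "integral {0..d} f = 0" using zero by (simp add: f_def[abs_def] w_def)
    moreover have "integral {d..x} f = integral {d..x} (\<lambda>_. 0)"
      using supp by (intro integral_spike[of "{d}"]) (auto simp: f_def)
    ultimately show ?thesis by (simp add: G_def)
  qed
  define X where "X u = u / (\<gamma> * (1 - u))" for u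
  have X0: "X u > 0" if "0 < u" "u < 1" for u using that g by (simp add: X_def)
  have X': "(X has_real_derivative X u / (u * (1 - u))) (at u)" if "0 < u" "u < 1" for u
    unfolding X_def[abs_def] using that g
    by (auto intro!: derivative_eq_intros simp: divide_simps) (simp add: algebra_simps)
  define \<psi> where "\<psi> u = (if 0 < u \<and> u < 1 then G (X u) / w (X u) else 0)" for u
  define D where "D u = (if 0 < u \<and> u < 1 then (\<phi> (X u) - \<eta> (X u) * (G (X u) / w (X u))) / (u * (1 - u)) else 0)" for u
  define u0 where "u0 = \<gamma> * c / (1 + \<gamma> * c)"
  define u1 where "u1 = \<gamma> * d / (1 + \<gamma> * d)"
  have u0: "0 < u0" using g cd gp[of c] by (simp add: u0_def)
  have u1: "u1 < 1" using g cd gp[of d] by (simp add: u1_def)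
  have low: "\<psi> u = 0" "D u = 0" if "u < u0" for u
  proof -
    have "X u < c" if "0 < u" "u < 1"
      using that \<open>u < u0\<close> g gp[of c] cd by (simp add: X_def u0_def divide_simps algebra_simps)
    then show "\<psi> u = 0" "D u = 0" using supp by (auto simp: \<psi>_def D_def G_low)
  qed
  have high: "\<psi> u = 0" "D u = 0" if "u > u1" for u
  proof -
    have "X u > d" if "0 < u" "u < 1"
      using that \<open>u > u1\<close> g gp[of d] cd by (simp add: X_def u1_def divide_simps algebra_simps)
    then show "\<psi> u = 0" "D u = 0" using supp by (auto simp: \<psi>_def D_def G_high)
  qed
  \<comment> \<open>below the support of $\varphi$ the primitive $G$ has not started, above it $G$ is back at zero by assumption\<close>
  have ev: "u \<in> {0<..<1} \<or> (eventually (\<lambda>v. \<psi> v = 0 \<and> D v = 0) (nhds u))" if "u \<in> {0..1}" for u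
  proof (cases "0 < u \<and> u < 1")
    case False
    then have "u = 0 \<or> u = 1" using that by auto
    then have "u \<in> {..<u0} \<union> {u1<..}" using u0 u1 by auto
    then have "eventually (\<lambda>v. v \<in> {..<u0} \<union> {u1<..}) (nhds u)"
      by (intro eventually_nhds_in_open) auto
    then have "eventually (\<lambda>v. \<psi> v = 0 \<and> D v = 0) (nhds u)" 
      by (rule eventually_mono) (use low high in auto)
    then show ?thesis by simp
  qed auto
  have psi_deriv: "(\<psi> has_real_derivative D u) (at u within {0..1})" if "u \<in> {0..1}" for u
  proof -
    have "(\<psi> has_real_derivative D u) (at u)"
    proof (cases "u \<in> {0<..<1}")
      case True
      then have u: "0 < u" "u < 1" by auto
      note x = X0[OF u]
      have "((\<lambda>u. G (X u) / w (X u)) has_real_derivative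
          (f (X u) * (X u / (u * (1 - u))) * w (X u) - G (X u) * ((w (X u) * \<eta> (X u) / X u) * (X u / (u * (1 - u))))) / (w (X u) * w (X u))) (at u)"
        using w0[OF x] by (intro DERIV_divide DERIV_chain2[of G] DERIV_chain2[of w] G' w' X' x u) auto
      also have "(f (X u) * (X u / (u * (1 - u))) * w (X u) - G (X u) * ((w (X u) * \<eta> (X u) / X u) * (X u / (u * (1 - u))))) / (w (X u) * w (X u)) = D u"
        using w0[OF x] x u by (simp add: D_def f_def divide_simps) (simp add: algebra_simps)
      finally have "((\<lambda>u. G (X u) / w (X u)) has_real_derivative D u) (at u)" .
      moreover have "eventually (\<lambda>v. G (X v) / w (X v) = \<psi> v) (nhds u)"
        using eventually_nhds_in_open[of "{0<..<1}" u] True by (auto elim!: eventually_mono simp: \<psi>_def)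
      ultimately show ?thesis using DERIV_cong_ev[OF refl _ refl, of "\<lambda>u. G (X u) / w (X u)" \<psi> u "D u"] by blast
    next
      case False
      with ev[OF that] have e: "eventually (\<lambda>v. \<psi> v = 0 \<and> D v = 0) (nhds u)" by auto
      then have "D u = 0" using eventually_nhds_x_imp_x by force
      moreover have "eventually (\<lambda>v. \<psi> v = 0) (nhds u)" using e by (auto elim!: eventually_mono)
      ultimately show ?thesis using DERIV_cong_ev[OF refl _ refl, of \<psi> "\<lambda>_. 0" u "D u"] by auto
    qed
    then show ?thesis by (rule has_field_derivative_at_within)
  qed
  have D_cont: "isCont D u" if "u \<in> {0..1}" for u
  proof (cases "u \<in> {0<..<1}")
    case True
    then have u: "0 < u" "u < 1" by auto
    note x = X0[OF u]
    have cX: "isCont X u" using X'[OF u] DERIV_isCont by blast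
    have "isCont (\<lambda>u. \<phi> (X u)) u" "isCont (\<lambda>u. G (X u)) u" "isCont (\<lambda>u. w (X u)) u"
      using isCont_o2[OF cX, of \<phi>] isCont_o2[OF cX, of G] isCont_o2[OF cX, of w] phi_cont w_cont[OF x] DERIV_isCont[OF G'[OF x]] 
      by auto
    then have "isCont (\<lambda>u. (\<phi> (X u) - \<eta> (X u) * (G (X u) / w (X u))) / (u * (1 - u))) u"
      using w0[OF x] u x cX gp[OF x] unfolding \<eta>_def by (intro continuous_intros) auto
    moreover have "eventually (\<lambda>v. D v = (\<phi> (X v) - \<eta> (X v) * (G (X v) / w (X v))) / (v * (1 - v))) (nhds u)"
      using eventually_nhds_in_open[of "{0<..<1}" u] True by (auto elim!: eventually_mono simp: D_def)
    ultimately show ?thesis 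
      using isCont_cong[of D "\<lambda>v. (\<phi> (X v) - \<eta> (X v) * (G (X v) / w (X v))) / (v * (1 - v))" u] by blast
  next
    case False
    with ev[OF that] have "eventually (\<lambda>v. D v = 0) (nhds u)" by (auto elim!: eventually_mono)
    then show ?thesis using isCont_cong[of D "\<lambda>_. 0" u] by auto
  qed
  show ?thesis
  proof (rule Stein_identity_C1[OF mu g hyp psi_deriv])
    show "continuous_on {0..1} D" using D_cont by (intro continuous_at_imp_continuous_on) auto
    show "\<psi> 0 = 0" by (simp add: \<psi>_def)
    show "\<phi> \<in> borel_measurable borel" using cont by (rule borel_measurable_continuous_onI)
    fix x z :: real assume x: "x > 0" and z: "z = \<gamma>*x/(1+\<gamma>*x)"
    have z01: "0 < z" "z < 1" using x gp[OF x] g by (auto simp: z)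
    have "1 - z = 1 / (1 + \<gamma> * x)" using gp[OF x] by (simp add: z field_simps)
    then have Xz: "X z = x" using gp[OF x] g by (simp add: X_def z)
    show "\<phi> x = z * (1-z) * D z + (l - m * (x/(1+x)) - n * z) * \<psi> z"
      using z01 by (simp add: D_def \<psi>_def Xz \<eta>_def z[symmetric])
  qed auto
qed

lemma GB_II_kernel_powr:
  "x > 0 \<Longrightarrow> GB_II_kernel \<nu> p q \<gamma> x = x powr (q + \<nu>) * (1+\<gamma>*x) powr (-(p + \<nu>)) * (1+x) powr (-(q - \<nu>)) / x"
  unfolding powr_minus by (simp add: GB_II_kernel_def powr_diff divide_simps)

lemma GB_II_kernel_nonpos: "x \<le> 0 \<Longrightarrow> GB_II_kernel \<nu> p q \<gamma> x = 0"
  by (simp add: GB_II_kernel_def)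

lemma sets_GB_II [simp, measurable_cong]: "sets (GB_II \<nu> p q \<gamma>) = sets borel"
  by (simp add: GB_II_def)

lemma GB_II_normalization_pos:
  assumes "\<gamma> > 0" "p > 0" "q > 0" "- q < \<nu>" "\<nu> < p"
  shows "(LINT t|lborel. GB_II_kernel \<nu> p q \<gamma> t) > 0"
proof -
  interpret prob_space "GB_II \<nu> p q \<gamma>" using assms by (rule prob_space_GB_II)
  have "(LINT t|lborel. GB_II_kernel \<nu> p q \<gamma> t) \<noteq> 0"
  proof
    assume "(LINT t|lborel. GB_II_kernel \<nu> p q \<gamma> t) = 0"
    then have "emeasure (GB_II \<nu> p q \<gamma>) (space (GB_II \<nu> p q \<gamma>)) = 0"
      by (simp add: GB_II_def emeasure_density)
    then show False by (simp add: emeasure_space_1)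
  qed
  moreover have "(LINT t|lborel. GB_II_kernel \<nu> p q \<gamma> t) \<ge> 0"
    by (simp add: GB_II_kernel_nonneg)
  ultimately show ?thesis by simp
qed

lemma AE_GB_II_pos: "AE x in GB_II \<nu> p q \<gamma>. x > 0"
proof -
  have "AE x in lborel. 0 < ennreal (GB_II_kernel \<nu> p q \<gamma> x / (LINT t|lborel. GB_II_kernel \<nu> p q \<gamma> t)) \<longrightarrow> x > 0"
    by (intro AE_I2) (auto simp: GB_II_kernel_nonpos intro: ccontr)
  then show ?thesis unfolding GB_II_def by (subst AE_density) auto
qed

text \<open>
  Continuous functions with compact support that converge to the indicator of $(s, \infty)$.
\<close>

definition bump :: "real \<Rightarrow> nat \<Rightarrow> real \<Rightarrow> real" where
  "bump s j y = max 0 (min 1 (j * (y - s))) * max 0 (min 1 (s + j + 1 - y))"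

lemma bump_bounds: "0 \<le> bump s j y" "bump s j y \<le> 1"
  by (auto simp: bump_def intro!: mult_le_one)

lemma bump_continuous: "continuous_on UNIV (bump s j)"
  unfolding bump_def[abs_def] by (intro continuous_intros)

lemma bump_measurable [measurable]: "bump s j \<in> borel_measurable borel"
  using bump_continuous by (rule borel_measurable_continuous_onI)

lemma bump_support: "y \<notin> {s..s + j + 1} \<Longrightarrow> bump s j y = 0"
proof -
  assume "y \<notin> {s..s + j + 1}"
  then consider "y - s \<le> 0" | "s + j + 1 - y \<le> 0" by fastforce
  then show "bump s j y = 0"
  proof cases
    case 1
    then have "j * (y - s) \<le> 0" by (intro mult_nonneg_nonpos) auto
    then show ?thesis by (simp add: bump_def)
  next
    case 2
    then show ?thesis by (simp add: bump_def)
  qed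
qed

lemma bump_tendsto: "(\<lambda>j. bump s j y) \<longlonglongrightarrow> indicator {s<..} y"
proof (cases "y > s")
  case True
  obtain N1 :: nat where N1: "1 < real N1 * (y - s)" using True reals_Archimedean3[of "y - s"] by auto
  obtain N2 :: nat where N2: "y - s < N2" using reals_Archimedean2 by blast
  have "bump s j y = 1" if "j \<ge> max N1 N2" for j
  proof -
    have "real N1 * (y - s) \<le> j * (y - s)" using that True by (intro mult_right_mono) auto
    moreover have "y - s < j" using N2 that by auto
    ultimately show ?thesis using N1 by (simp add: bump_def)
  qed
  then have "eventually (\<lambda>j. bump s j y = 1) sequentially" unfolding eventually_sequentially by blast
  then show ?thesis using True by (simp add: tendsto_eventually)
next
  case False
  then have "j * (y - s) \<le> 0" for j :: nat by (intro mult_nonneg_nonpos) auto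
  moreover have "max 0 (min 1 t) = 0" if "t \<le> 0" for t :: real using that by auto
  ultimately have "max 0 (min 1 (j * (y - s))) = 0" for j :: nat by blast
  then have "bump s j y = 0" for j by (simp add: bump_def)
  then show ?thesis using False by simp
qed

lemma bump_integral_tendsto:
  assumes "prob_space \<mu>" "sets \<mu> = sets borel"
  shows "(\<lambda>j. LINT y|\<mu>. bump s j y) \<longlonglongrightarrow> measure \<mu> {s<..}"
proof -
  interpret prob_space \<mu> by fact
  note [measurable_cong] = assms(2)
  have "(\<lambda>j. LINT y|\<mu>. bump s j y) \<longlonglongrightarrow> (LINT y|\<mu>. indicator {s<..} y)"
    by (rule integral_dominated_convergence[where w = "\<lambda>_. 1"])
       (auto simp: bump_bounds bump_tendsto abs_of_nonneg)
  then show ?thesis using assms(2) sets_eq_imp_space_eq[OF assms(2)] by simp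
qed

lemma measure_tails_from_right:
  assumes "prob_space \<mu>" "sets \<mu> = sets borel" and pos: "AE x in \<mu>. x > 0"
  shows "(\<lambda>j. measure \<mu> {1 / real (Suc j)<..}) \<longlonglongrightarrow> 1"
proof -
  interpret prob_space \<mu> by fact
  note [measurable_cong] = assms(2)
  have "(\<lambda>j. measure \<mu> {1 / real (Suc j)<..}) \<longlonglongrightarrow> measure \<mu> (\<Union>j. {1 / real (Suc j)<..})"
    by (intro finite_Lim_measure_incseq) 
       (auto simp: incseq_def frac_le intro: order.strict_trans1[rotated] dest: order.strict_trans1[rotated])
  also have "(\<Union>j. {1 / real (Suc j)<..}) = {0<..}"
  proof (intro equalityI subsetI)
    fix y :: real assume "y \<in> {0<..}"
    then obtain j where "inverse (real (Suc j)) < y" using reals_Archimedean by auto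
    then show "y \<in> (\<Union>j. {1 / real (Suc j)<..})" by (auto simp: inverse_eq_divide)
  qed (auto intro: order.strict_trans[rotated])
  also have "measure \<mu> {0<..} = 1"
    using pos by (intro prob_eq_1[THEN iffD2]) auto
  finally show ?thesis .
qed

lemma integral_times_GB_II_kernel:
  assumes par: "\<gamma> > 0" "p > 0" "q > 0" "- q < \<nu>" "\<nu> < p"
    and cd: "0 < c" "c < d" and cont: "continuous_on UNIV \<phi>" and supp: "\<And>x. x \<notin> {c..d} \<Longrightarrow> \<phi> x = 0"
  shows "integral {0..d} (\<lambda>x. \<phi> x * (x powr (q + \<nu>) * (1+\<gamma>*x) powr (-(p + \<nu>)) * (1+x) powr (-(q - \<nu>))) / x)
     = (LINT t|lborel. GB_II_kernel \<nu> p q \<gamma> t) * (LINT x|GB_II \<nu> p q \<gamma>. \<phi> x)"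
proof -
  let ?k = "GB_II_kernel \<nu> p q \<gamma>"
  define I where "I = (LINT t|lborel. ?k t)"
  have I: "I > 0" unfolding I_def by (rule GB_II_normalization_pos[OF par])
  have [measurable]: "\<phi> \<in> borel_measurable borel" using cont by (rule borel_measurable_continuous_onI)
  have "compact (\<phi> ` {c..d})"
    using cont by (intro compact_continuous_image) (auto intro: continuous_on_subset)
  then obtain C where C: "\<And>x. x \<in> {c..d} \<Longrightarrow> \<bar>\<phi> x\<bar> \<le> C"
    using compact_imp_bounded bounded_iff by (metis image_eqI real_norm_def)
  then have C': "\<bar>\<phi> x\<bar> \<le> \<bar>C\<bar>" for x
    using supp by (cases "x \<in> {c..d}") (force simp: supp)+
  have int: "integrable lborel (\<lambda>x. \<phi> x * ?k x)"
  proof (rule Bochner_Integration.integrable_bound)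
    show "integrable lborel (\<lambda>x. \<bar>C\<bar> * ?k x)" using integrable_GB_II_kernel[OF par] by simp
    show "AE x in lborel. norm (\<phi> x * ?k x) \<le> norm (\<bar>C\<bar> * ?k x)"
      using C' by (intro AE_I2) (auto simp: abs_mult intro!: mult_right_mono)
  qed measurable
  have "(LINT x|GB_II \<nu> p q \<gamma>. \<phi> x) = (LINT x|lborel. ?k x / I * \<phi> x)"
    unfolding GB_II_def I_def[symmetric] using I
    by (subst integral_density) (auto simp: GB_II_kernel_nonneg)
  also have "\<dots> = (LINT x|lborel. \<phi> x * ?k x) / I"
    by (simp add: field_simps)
  finally have 1: "I * (LINT x|GB_II \<nu> p q \<gamma>. \<phi> x) = (LINT x|lborel. \<phi> x * ?k x)"
    using I by simp
  also have "\<dots> = integral UNIV (\<lambda>x. \<phi> x * ?k x)"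
    using int by (simp add: integral_lborel)
  also have "\<dots> = integral UNIV (\<lambda>x. if x \<in> {0..d} then \<phi> x * (x powr (q + \<nu>) * (1+\<gamma>*x) powr (-(p + \<nu>)) * (1+x) powr (-(q - \<nu>))) / x else 0)"
  proof (rule integral_cong)
    fix x :: real
    show "\<phi> x * ?k x = (if x \<in> {0..d} then \<phi> x * (x powr (q + \<nu>) * (1+\<gamma>*x) powr (-(p + \<nu>)) * (1+x) powr (-(q - \<nu>))) / x else 0)"
      using supp[of x] cd by (cases "x > 0") (auto simp: GB_II_kernel_powr)
  qed
  also have "\<dots> = integral {0..d} (\<lambda>x. \<phi> x * (x powr (q + \<nu>) * (1+\<gamma>*x) powr (-(p + \<nu>)) * (1+x) powr (-(q - \<nu>))) / x)"
    by (rule integral_restrict_UNIV)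
  finally show ?thesis by (simp add: I_def)
qed

text \<open>
  Test functions with mean zero under $\mathrm{GB}_{II}$ have mean zero under $\mu$, so $\mu$ and $\mathrm{GB}_{II}$ are proportional on test functions. Convergence of the
  bumps turns this into proportionality of the tails, and letting the tail grow to the whole half-line shows that the
  factor is $1$.
\<close>

lemma GB_II_from_Stein_identities:
  fixes \<mu> :: "real measure" and \<gamma> p q \<nu> :: real
  assumes mu: "prob_space \<mu>" "sets \<mu> = sets borel" "AE x in \<mu>. x > 0"
    and par: "\<gamma> > 0" "p > 0" "q > 0" "- q < \<nu>" "\<nu> < p"
    and hyp: "\<And>k::nat. (LINT x|\<mu>. (\<gamma>*x/(1+\<gamma>*x))^k *
      ((q + \<nu> + k) - (q - \<nu>) * (x/(1+x)) - (p + \<nu> + k) * (\<gamma>*x/(1+\<gamma>*x)))) = 0"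
  shows "\<mu> = GB_II \<nu> p q \<gamma>"
proof -
  define N where "N = GB_II \<nu> p q \<gamma>"
  have N: "prob_space N" "sets N = sets borel" "AE x in N. x > 0"
    unfolding N_def using prob_space_GB_II[OF par] AE_GB_II_pos by auto
  interpret M: prob_space \<mu> by fact
  interpret N: prob_space N by fact
  note [measurable_cong] = mu(2) N(2)
  have bump_int: "integrable \<mu> (bump s j)" "integrable N (bump s j)" for s j
    by (auto intro!: M.integrable_const_bound[where B = 1] N.integrable_const_bound[where B = 1] simp: bump_bounds abs_of_nonneg)
  have test: "(LINT x|\<mu>. bump s j x - r * bump s' j' x) = 0"
    if "(LINT x|N. bump s j x - r * bump s' j' x) = 0" "s > 0" "s' > 0" for s j r s' j'
  proof -
    define d where "d = max (s + j + 1) (s' + j' + 1)"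
    let ?\<phi> = "\<lambda>x. bump s j x - r * bump s' j' x"
    have c: "0 < min s s'" "min s s' < d" using that by (auto simp: d_def)
    have cont: "continuous_on UNIV ?\<phi>" by (intro continuous_intros bump_continuous)
    have supp: "?\<phi> x = 0" if "x \<notin> {min s s'..d}" for x
    proof -
      have "bump s j x = 0" "bump s' j' x = 0"
        using that by (auto intro!: bump_support simp: d_def)
      then show ?thesis by simp
    qed
    show ?thesis
      by (rule annihilates_test_functions[OF mu par(1) hyp c cont supp])
         (use integral_times_GB_II_kernel[OF par c cont supp] that(1) in \<open>simp_all add: N_def\<close>)
  qed
  have "\<exists>s j. s > 0 \<and> (LINT x|N. bump s j x) \<noteq> 0"
  proof (rule ccontr)
    assume "\<not> ?thesis"
    then have "(LINT x|N. bump s j x) = 0" if "s > 0" for s j using that by blast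
    then have "measure N {s<..} = 0" if "s > 0" for s
      using bump_integral_tendsto[OF N(1,2), of s] that by (simp add: LIMSEQ_const_iff)
    then have "(\<lambda>j::nat. 0::real) \<longlonglongrightarrow> 1"
      using measure_tails_from_right[OF N] by simp
    then show False by (simp add: LIMSEQ_const_iff)
  qed
  then obtain s0 j0 where s0: "s0 > 0" "(LINT x|N. bump s0 j0 x) \<noteq> 0" by blast
  define C where "C = (LINT x|\<mu>. bump s0 j0 x) / (LINT x|N. bump s0 j0 x)"
  have bump_eq: "(LINT x|\<mu>. bump s j x) = C * (LINT x|N. bump s j x)" if "s > 0" for s j
  proof -
    define r where "r = (LINT x|N. bump s j x) / (LINT x|N. bump s0 j0 x)"
    have "(LINT x|N. bump s j x - r * bump s0 j0 x) = 0"
      using bump_int s0(2) by (simp add: r_def)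
    from test[OF this that s0(1)] show ?thesis
      using bump_int s0(2) by (simp add: r_def C_def field_simps)
  qed
  have tail: "measure \<mu> {s<..} = C * measure N {s<..}" if "s > 0" for s
  proof (rule LIMSEQ_unique[OF bump_integral_tendsto[OF mu(1,2)]])
    show "(\<lambda>j. LINT x|\<mu>. bump s j x) \<longlonglongrightarrow> C * measure N {s<..}"
      unfolding bump_eq[OF that] by (intro tendsto_mult_left bump_integral_tendsto[OF N(1,2)])
  qed
  have "(\<lambda>j. measure \<mu> {1 / real (Suc j)<..}) \<longlonglongrightarrow> C * 1"
    using tendsto_mult_left[OF measure_tails_from_right[OF N], of C] by (simp add: tail)
  from LIMSEQ_unique[OF this measure_tails_from_right[OF mu]] have "C = 1" by simp
  have "emeasure \<mu> {s<..} = emeasure N {s<..}" for s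
  proof (cases "s > 0")
    case True
    then show ?thesis using tail[OF True] \<open>C = 1\<close> by (simp add: M.emeasure_eq_measure N.emeasure_eq_measure)
  next
    case False
    have "measure \<mu> {s<..} = 1" "measure N {s<..} = 1"
      using mu(3) N(3) False by (auto intro!: M.prob_eq_1[THEN iffD2] N.prob_eq_1[THEN iffD2] elim!: eventually_mono)
    then show ?thesis by (simp add: M.emeasure_eq_measure N.emeasure_eq_measure)
  qed
  then have "\<mu> = N" using mu(2) N(2) by (intro measure_eqI_lessThan) (auto simp: N.emeasure_eq_measure)
  then show ?thesis by (simp add: N_def)
qed

section \<open>Laws from contiguous relations between moments\<close>

lemma (in pos_law) GB_II_from_moments:
  fixes p q \<nu> :: real
  assumes par: "p > 0" "q > 0" "- q < \<nu>" "\<nu> < p"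
    and rec: "\<And>k::nat. (q - \<nu>) * mom \<gamma> \<mu> 1 0 k 0 + (p + \<nu> + k) * mom \<gamma> \<mu> 0 0 (real k + 1) 0 = (q + \<nu> + k) * mom \<gamma> \<mu> 0 0 k 0"
  shows "\<mu> = GB_II \<nu> p q \<gamma>"
proof (rule GB_II_from_Stein_identities[OF prob_space_axioms sets_law AE_pos \<gamma>_pos par])
  fix k :: nat
  have "(LINT x|\<mu>. (\<gamma>*x/(1+\<gamma>*x))^k * ((q + \<nu> + k) - (q - \<nu>) * (x/(1+x)) - (p + \<nu> + k) * (\<gamma>*x/(1+\<gamma>*x))))
      = (LINT x|\<mu>. (q + \<nu> + k) * kern \<gamma> 0 0 k 0 x - (q - \<nu>) * kern \<gamma> 1 0 k 0 x - (p + \<nu> + k) * kern \<gamma> 0 0 (real k + 1) 0 x)"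
  proof (rule integral_cong_AE)
    show "AE x in \<mu>. (\<gamma>*x/(1+\<gamma>*x))^k * ((q + \<nu> + k) - (q - \<nu>) * (x/(1+x)) - (p + \<nu> + k) * (\<gamma>*x/(1+\<gamma>*x)))
      = (q + \<nu> + k) * kern \<gamma> 0 0 k 0 x - (q - \<nu>) * kern \<gamma> 1 0 k 0 x - (p + \<nu> + k) * kern \<gamma> 0 0 (real k + 1) 0 x"
      using AE_pos
    proof eventually_elim
      case (elim x)
      have "(\<gamma>*x/(1+\<gamma>*x))^k = kern \<gamma> 0 0 k 0 x"
        using elim coords[OF \<gamma>_pos elim] \<gamma>_pos by (simp add: kern_def powr_realpow)
      then show ?case
        using kern_shift(1)[OF \<gamma>_pos elim, of 0 0 k 0] kern_shift(3)[OF \<gamma>_pos elim, of 0 0 k 0]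
        by (simp add: algebra_simps)
    qed
  qed measurable
  also have "\<dots> = (q + \<nu> + k) * mom \<gamma> \<mu> 0 0 k 0 - (q - \<nu>) * mom \<gamma> \<mu> 1 0 k 0 - (p + \<nu> + k) * mom \<gamma> \<mu> 0 0 (real k + 1) 0"
    unfolding mom_def by (simp add: kern_integrable)
  finally show "(LINT x|\<mu>. (\<gamma>*x/(1+\<gamma>*x))^k * ((q + \<nu> + k) - (q - \<nu>) * (x/(1+x)) - (p + \<nu> + k) * (\<gamma>*x/(1+\<gamma>*x)))) = 0"
    using rec[of k] by (simp add: add.commute)
qed

text \<open>
  The relations at the exponents $0$, $A$ and $P$ combine to $\mathrm{E}[(mA + nP - l)^2] = 0$, and $mA + nP$ is a strictly
  increasing function of $x$.
\<close>

lemma (in pos_law) Dirac_from_moments: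
  assumes lmn: "l > 0" "m > 0" "n > 0"
    and rec: "\<And>a p::nat. m * mom \<gamma> \<mu> (real a + 1) 0 p 0 + n * mom \<gamma> \<mu> a 0 (real p + 1) 0 = l * mom \<gamma> \<mu> a 0 p 0"
  shows "\<exists>c. AE x in \<mu>. x = c"
proof -
  define f where "f x = m * (x/(1+x)) + n * (\<gamma>*x/(1+\<gamma>*x)) - l" for x
  define R where "R a p x = m * kern \<gamma> (a + 1) 0 p 0 x + n * kern \<gamma> a 0 (p + 1) 0 x - l * kern \<gamma> a 0 p 0 x" for a p x
  have R0: "(LINT x|\<mu>. R (real a) (real p) x) = 0" for a p
    using rec[of a p] unfolding R_def mom_def by (simp add: kern_integrable)
  have R_int: "integrable \<mu> (R (real a) (real p))" for a p
    unfolding R_def[abs_def] by (simp add: kern_integrable)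
  have Rf: "R a p x = kern \<gamma> a 0 p 0 x * f x" if "x > 0" for a p x
    unfolding R_def f_def kern_shift[OF \<gamma>_pos that] by (simp add: algebra_simps)
  \<comment> \<open>$S = (mA + nP - l)^2$ on the half-line, expanded into monomials\<close>
  define S where "S x = m * R 1 0 x + n * R 0 1 x - l * R 0 0 x" for x
  have S_int: "integrable \<mu> S" 
    unfolding S_def[abs_def] using R_int[of 1 0] R_int[of 0 1] R_int[of 0 0] by simp
  have S0: "(LINT x|\<mu>. S x) = 0"
    unfolding S_def[abs_def] using R_int[of 1 0] R_int[of 0 1] R_int[of 0 0] R0[of 1 0] R0[of 0 1] R0[of 0 0] by simp
  have Sf: "S x = f x ^ 2" if "x > 0" for x
  proof -
    have "kern \<gamma> 0 0 0 0 x = 1" using that coords[OF \<gamma>_pos that] \<gamma>_pos by (simp add: kern_def)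
    then show ?thesis
      using kern_shift(1,3)[OF \<gamma>_pos that, of 0 0 0 0]
      unfolding S_def Rf[OF that] f_def by (simp add: power2_eq_square algebra_simps)
  qed
  have "AE x in \<mu>. 0 \<le> S x" using AE_pos by eventually_elim (simp add: Sf)
  then have "AE x in \<mu>. S x = 0" using integral_nonneg_eq_0_iff_AE[OF S_int] S0 by simp
  then have f0: "AE x in \<mu>. x > 0 \<and> f x = 0" using AE_pos by eventually_elim (simp add: Sf)
  then obtain c where c: "c > 0" "f c = 0"
    using eventually_happens[OF f0] by (auto simp: trivial_limit_def ae_filter_eq_bot_iff emeasure_space_1)
  have mono: "f x < f y" if "0 < x" "x < y" for x y
  proof -
    have 1: "t * x/(1+t*x) < t * y/(1+t*y)" if "t > 0" for t
    proof -
      have "1 + t * x > 0" "1 + t * y > 0" using that \<open>0 < x\<close> \<open>x < y\<close> by (auto intro!: add_pos_pos)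
      then show ?thesis using that \<open>x < y\<close> by (simp add: divide_simps algebra_simps)
    qed
    have "m * (x/(1+x)) < m * (y/(1+y))" "n * (\<gamma>*x/(1+\<gamma>*x)) < n * (\<gamma>*y/(1+\<gamma>*y))"
      using mult_strict_left_mono[OF 1[of 1] lmn(2)] mult_strict_left_mono[OF 1[OF \<gamma>_pos] lmn(3)] by simp_all
    then show ?thesis by (simp add: f_def)
  qed
  have "AE x in \<mu>. x = c"
    using f0
  proof eventually_elim
    case (elim x)
    then show ?case using mono[of x c] mono[of c x] c by (cases x c rule: linorder_cases) auto
  qed
  then show ?thesis by blast
qed

section \<open>The functional equation for the four families of moments\<close>

text \<open>
  For $Y$ and $U$ the quantities $P$ and $Q$ exchange their roles, and so do the last two arguments of the moments.
  In terms of the introduction, $g$ and $h$ at $w = (a, b, p, q)$ are \<open>G a b q p\<close> and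
  \<open>H a b q p\<close>; in particular, the shift by $P$ raises their last argument.
\<close>

locale quad_laws = X: pos_law \<mu>X \<alpha> + Y: pos_law \<mu>Y \<beta> + U: pos_law \<mu>U \<alpha> + V: pos_law \<mu>V \<beta>
  for \<mu>X \<mu>Y \<mu>U \<mu>V :: "real measure" and \<alpha> \<beta> :: real +
  assumes neq: "\<alpha> \<noteq> \<beta>"
    and mom_prod: "\<And>a b p q. a \<ge> 0 \<Longrightarrow> b \<ge> 0 \<Longrightarrow> p \<ge> 0 \<Longrightarrow> q \<ge> 0 \<Longrightarrow>
      mom \<alpha> \<mu>X a b p q * mom \<beta> \<mu>Y a b q p = mom \<alpha> \<mu>U a b q p * mom \<beta> \<mu>V a b p q"
begin

abbreviation "F \<equiv> mom \<alpha> \<mu>X"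
abbreviation "G \<equiv> mom \<beta> \<mu>Y"
abbreviation "H \<equiv> mom \<alpha> \<mu>U"
abbreviation "K \<equiv> mom \<beta> \<mu>V"

text \<open>
  The numerator of $\tau_A \tau_B - \tau_P \tau_Q$. As a polynomial in moments it is analytic in each exponent.
\<close>

definition det where
  "det a b p q = F (a+1) b p q * F a (b+1) p q * (H a b q (p+1) * H a b (q+1) p)
     - F a b (p+1) q * F a b p (q+1) * (H (a+1) b q p * H a (b+1) q p)"

definition swapA where "swapA a b p q = G (a+1) b q p * H a b q p - H (a+1) b q p * G a b q p"
definition swapQ where "swapQ a b p q = G a b (q+1) p * H a b q p - H a b (q+1) p * G a b q p"

lemma swap_if_det_nonzero:
  assumes w: "a \<ge> 0" "b \<ge> 0" "p \<ge> 0" "q \<ge> 0" and "det a b p q \<noteq> 0"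
  shows "swapA a b p q = 0" "swapQ a b p q = 0"
proof -
  have w1: "a + 1 \<ge> 0" "b + 1 \<ge> 0" "p + 1 \<ge> 0" "q + 1 \<ge> 0" using w by auto
  have nd: "F (a+1) b p q * F a (b+1) p q * (H a b q (p+1) * H a b (q+1) p)
     \<noteq> F a b (p+1) q * F a b p (q+1) * (H (a+1) b q p * H a (b+1) q p)"
    using assms(5) by (simp add: det_def)
  note d = dichotomy[OF
    U.mom_pos[OF w(1,2,4,3)] U.mom_pos[OF w1(1) w(2,4,3)] U.mom_pos[OF w(1) w1(2) w(4,3)]
    U.mom_pos[OF w(1,2,4) w1(3)] U.mom_pos[OF w(1,2) w1(4) w(3)]
    X.mom_AQ[OF w] X.mom_BP[OF w] U.mom_AQ[OF w(1,2,4,3)] U.mom_BP[OF w(1,2,4,3)]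
    V.mom_AQ[OF w] V.mom_BP[OF w] Y.mom_AQ[OF w(1,2,4,3)] Y.mom_BP[OF w(1,2,4,3)]
    mom_prod[OF w] mom_prod[OF w1(1) w(2-4)] mom_prod[OF w(1) w1(2) w(3,4)]
    mom_prod[OF w(1,2) w1(3) w(4)] mom_prod[OF w(1-3) w1(4)] nd]
  show "swapA a b p q = 0" "swapQ a b p q = 0" using d by (auto simp: swapA_def swapQ_def)
qed

lemma swap_B_P:
  assumes w: "a \<ge> 0" "b \<ge> 0" "p \<ge> 0" "q \<ge> 0" and "swapA a b p q = 0" "swapQ a b p q = 0"
  shows "G a (b+1) q p * H a b q p = H a (b+1) q p * G a b q p"
    "G a b q (p+1) * H a b q p = H a b q (p+1) * G a b q p"
proof -
  have e: "G a (b+1) q p = G a b q p - G a b (q+1) p" "H a (b+1) q p = H a b q p - H a b (q+1) p"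
    "G a b q (p+1) = G a b q p - G (a+1) b q p" "H a b q (p+1) = H a b q p - H (a+1) b q p"
    using Y.mom_AQ[OF w(1,2,4,3)] Y.mom_BP[OF w(1,2,4,3)] U.mom_AQ[OF w(1,2,4,3)] U.mom_BP[OF w(1,2,4,3)] by auto
  then show "G a (b+1) q p * H a b q p = H a (b+1) q p * G a b q p"
    "G a b q (p+1) * H a b q p = H a b q (p+1) * G a b q p"
    unfolding e using assms(5,6) by (simp_all add: swapA_def swapQ_def left_diff_distrib)
qed

lemma right_analytic_det:
  assumes w: "a \<ge> 0" "b \<ge> 0" "p \<ge> 0" "q \<ge> 0"
  shows "right_analytic (\<lambda>t. det (a + t) b p q)" "right_analytic (\<lambda>t. det a b (p + t) q)"
    "right_analytic (\<lambda>t. swapA (a + t) b p q)" "right_analytic (\<lambda>t. swapA a b (p + t) q)"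
    "right_analytic (\<lambda>t. swapQ (a + t) b p q)" "right_analytic (\<lambda>t. swapQ a b (p + t) q)"
proof -
  have c: "x + t + 1 = (x + 1) + t" for x t :: real by simp
  show "right_analytic (\<lambda>t. det (a + t) b p q)" "right_analytic (\<lambda>t. det a b (p + t) q)"
    "right_analytic (\<lambda>t. swapA (a + t) b p q)" "right_analytic (\<lambda>t. swapA a b (p + t) q)"
    "right_analytic (\<lambda>t. swapQ (a + t) b p q)" "right_analytic (\<lambda>t. swapQ a b (p + t) q)"
    unfolding det_def swapA_def swapQ_def c using w
    by (intro right_analytic_diff right_analytic_mult X.right_analytic_mom Y.right_analytic_mom U.right_analytic_mom; simp)+
qed

text \<open>
  A nonzero determinant at $w$ would make the swap hold at $w$, $w + A$ and $w + P$. Then the ratios of $g$ and $h$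
  agree both along $A, B$ and along $P, Q$. Since $g_{PQ} = \beta g_{AB}$ and $h_{PQ} = \alpha h_{AB}$, this contradicts
  $\alpha \ne \beta$.
\<close>

lemma det_zero:
  assumes w: "a \<ge> 0" "b \<ge> 0" "p \<ge> 0" "q \<ge> 0"
  shows "det a b p q = 0"
proof (rule ccontr)
  assume nz: "det a b p q \<noteq> 0"
  have w1: "a + 1 \<ge> 0" "b + 1 \<ge> 0" "p + 1 \<ge> 0" "q + 1 \<ge> 0" using w by auto
  note ra = right_analytic_det[OF w]
  have zA: "swapA (a + t) b p q * det (a + t) b p q = 0" "swapQ (a + t) b p q * det (a + t) b p q = 0"
    if "t \<ge> 0" for t
    using swap_if_det_nonzero[of "a + t" b p q] w that by auto
  have zP: "swapA a b (p + t) q * det a b (p + t) q = 0" "swapQ a b (p + t) q * det a b (p + t) q = 0"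
    if "t \<ge> 0" for t
    using swap_if_det_nonzero[of a b "p + t" q] w that by auto
  have s0: "swapA a b p q = 0" "swapQ a b p q = 0" using swap_if_det_nonzero[OF w nz] .
  have sA: "swapA (a + 1) b p q = 0" "swapQ (a + 1) b p q = 0"
    using right_analytic_zero_product[OF ra(3) ra(1) zA(1), of 1] right_analytic_zero_product[OF ra(5) ra(1) zA(2), of 1] nz
    by auto
  have sP: "swapA a b (p + 1) q = 0" "swapQ a b (p + 1) q = 0"
    using right_analytic_zero_product[OF ra(4) ra(2) zP(1), of 1] right_analytic_zero_product[OF ra(6) ra(2) zP(2), of 1] nz
    by auto
  define g h where "g = G a b q p" and "h = H a b q p"
  have gh: "g > 0" "h > 0" using Y.mom_pos[OF w(1,2,4,3)] U.mom_pos[OF w(1,2,4,3)] by (auto simp: g_def h_def)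
  have chain: "g2 * h = h2 * g" if "g2 * h1 = h2 * g1" "g1 * h = h1 * g" "h1 > 0" for g1 h1 g2 h2
  proof -
    have "h1 * (g2 * h) = h1 * (h2 * g)" using that(1,2) by (metis mult.commute mult.left_commute)
    then show ?thesis using that(3) by simp
  qed
  have 1: "G (a+1) (b+1) q p * h = H (a+1) (b+1) q p * g"
    using chain[OF swap_B_P(1)[OF w1(1) w(2-4) sA]] s0(1) U.mom_pos[OF w1(1) w(2,4,3)]
    by (simp add: swapA_def g_def h_def)
  have 2: "G a b (q+1) (p+1) * h = H a b (q+1) (p+1) * g"
    using chain[of "G a b (q+1) (p+1)" "H a b q (p+1)" "H a b (q+1) (p+1)" "G a b q (p+1)"]
      sP(2) swap_B_P(2)[OF w s0] U.mom_pos[OF w(1,2,4) w1(3)]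
    by (simp add: swapQ_def g_def h_def)
  have "\<beta> * G (a+1) (b+1) q p * h = \<alpha> * H (a+1) (b+1) q p * g"
    using 2 Y.mom_PQ[of a b q p] U.mom_PQ[of a b q p] by simp
  then have "(\<beta> - \<alpha>) * (H (a+1) (b+1) q p * g) = 0" using 1 by (simp add: algebra_simps)
  then show False using neq gh U.mom_pos[OF w1(1,2) w(4,3)] by simp
qed

definition \<tau> where "\<tau> a b p q = F a b p q / H a b q p"

lemma \<tau>_alt:
  assumes w: "a \<ge> 0" "b \<ge> 0" "p \<ge> 0" "q \<ge> 0"
  shows "\<tau> a b p q = K a b p q / G a b q p"
  using mom_prod[OF w] Y.mom_pos[OF w(1,2,4,3)] U.mom_pos[OF w(1,2,4,3)] 
  by (simp add: \<tau>_def field_simps)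

lemma \<tau>_relations:
  assumes w: "a \<ge> 0" "b \<ge> 0" "p \<ge> 0" "q \<ge> 0"
  shows "\<tau> a b p q > 0"
    and "\<tau> (a+1) (b+1) p q = \<tau> a b (p+1) (q+1)"
    and "\<tau> (a+1) b p q * \<tau> a (b+1) p q = \<tau> a b (p+1) q * \<tau> a b p (q+1)"
    and "\<tau> a b (p+1) q * \<tau> a b p q + \<tau> (a+1) b p q * \<tau> a b p q
       = \<tau> a b (p+1) q * \<tau> a b p (q+1) + \<tau> (a+1) b p q * \<tau> a b (p+1) q"
    and "\<tau> (a+1) (b+1) p q * \<tau> a b p q = \<tau> (a+1) b p q * \<tau> a (b+1) p q"
proof -
  have w1: "a + 1 \<ge> 0" "b + 1 \<ge> 0" "p + 1 \<ge> 0" "q + 1 \<ge> 0" using w by auto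
  have hpos: "H a b q p > 0" "H (a+1) b q p > 0" "H a (b+1) q p > 0" "H a b q (p+1) > 0" "H a b (q+1) p > 0" "H (a+1) (b+1) q p > 0"
    and gpos: "G a b q p > 0" "G (a+1) b q p > 0" "G a (b+1) q p > 0" "G a b q (p+1) > 0" "G a b (q+1) p > 0" "G (a+1) (b+1) q p > 0"
    by (rule U.mom_pos Y.mom_pos; use w in simp)+
  show "\<tau> a b p q > 0" using X.mom_pos[OF w] hpos by (simp add: \<tau>_def)
  show "\<tau> (a+1) (b+1) p q = \<tau> a b (p+1) (q+1)"
    using X.\<gamma>_pos by (simp add: \<tau>_def X.mom_PQ U.mom_PQ)
  have d: "F (a+1) b p q * F a (b+1) p q * (H a b q (p+1) * H a b (q+1) p)
     = F a b (p+1) q * F a b p (q+1) * (H (a+1) b q p * H a (b+1) q p)"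
    using det_zero[OF w] by (simp add: det_def)
  then show t: "\<tau> (a+1) b p q * \<tau> a (b+1) p q = \<tau> a b (p+1) q * \<tau> a b p (q+1)"
    using hpos by (simp add: \<tau>_def field_simps)
  show "\<tau> a b (p+1) q * \<tau> a b p q + \<tau> (a+1) b p q * \<tau> a b p q
       = \<tau> a b (p+1) q * \<tau> a b p (q+1) + \<tau> (a+1) b p q * \<tau> a b (p+1) q"
    unfolding \<tau>_def
    by (rule rank_relation[OF hpos(1-5) X.mom_AQ[OF w] X.mom_BP[OF w] U.mom_AQ[OF w(1,2,4,3)] U.mom_BP[OF w(1,2,4,3)] d])
  show "\<tau> (a+1) (b+1) p q * \<tau> a b p q = \<tau> (a+1) b p q * \<tau> a (b+1) p q"
  proof (cases "\<alpha> = 1")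
    case False
    show ?thesis
      using multiplicative_of_det[OF X.mom_AQ[OF w] X.mom_BP[OF w] U.mom_AQ[OF w(1,2,4,3)] U.mom_BP[OF w(1,2,4,3)]
          X.mom_AB[OF w] U.mom_AB[OF w(1,2,4,3)] False d] hpos
      by (simp add: \<tau>_def field_simps)
  next
    case True
    then have b: "\<beta> \<noteq> 1" using neq by simp
    have kg: "K (a+1) b p q * K a (b+1) p q * (G a b q (p+1) * G a b (q+1) p)
     = K a b (p+1) q * K a b p (q+1) * (G (a+1) b q p * G a (b+1) q p)"
      using t w gpos by (simp add: \<tau>_alt field_simps)
    \<comment> \<open>now $\beta$ differs from $1$, and $k, g$ take over the roles of $f, h$\<close>
    show ?thesis
      using multiplicative_of_det[OF V.mom_AQ[OF w] V.mom_BP[OF w] Y.mom_AQ[OF w(1,2,4,3)] Y.mom_BP[OF w(1,2,4,3)]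
          V.mom_AB[OF w] Y.mom_AB[OF w(1,2,4,3)] b kg] gpos w
      by (simp add: \<tau>_alt field_simps)
  qed
qed

definition T :: "nat \<Rightarrow> nat \<Rightarrow> nat \<Rightarrow> nat \<Rightarrow> real" where "T a b p q = \<tau> a b p q"

sublocale lattice_ratio T
  by unfold_locales (use \<tau>_relations[of "real _" "real _" "real _" "real _"] in \<open>auto simp: T_def add.commute[of 1]\<close>)

text \<open>
  Since $f = \tau h$ and likewise at the shifted exponents, $m f_A + n f_P = \tau l (h_A + h_P) = l f$, and
  symmetrically for the other three laws.
\<close>

lemma contiguous_relations:
  assumes r: "rep T a b p q l m n s"
  shows "m * F (real a + 1) b p q + n * F a b (real p + 1) q = l * F a b p q"
    and "l * H (real a + 1) b q p + s * H a b (real q + 1) p = m * H a b q p"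
    and "m * K (real a + 1) b p q + n * K a b (real p + 1) q = l * K a b p q"
    and "l * G (real a + 1) b q p + s * G a b (real q + 1) p = m * G a b q p"
proof -
  have key: "m * f1 + n * f2 = l * f \<and> l * h1 + s * h3 = m * h"
    if r: "t1 * m = t * l" "t2 * n = t * l" "t3 * m = t * s" 
      and t: "f = t * h" "f1 = t1 * h1" "f2 = t2 * h2" "f3 = t3 * h3" "t > 0"
      and s: "h1 + h2 = h" "f1 + f3 = f" for t t1 t2 t3 f f1 f2 f3 h h1 h2 h3
  proof
    have "m * f1 + n * f2 = (t1 * m) * h1 + (t2 * n) * h2" using t by simp
    also have "\<dots> = l * (t * (h1 + h2))" by (simp only: r) (simp add: algebra_simps)
    finally show "m * f1 + n * f2 = l * f" using s t by simp
    have "t * (l * h1 + s * h3) = (t1 * m) * h1 + (t3 * m) * h3" by (simp only: r) (simp add: algebra_simps)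
    also have "\<dots> = m * (f1 + f3)" using t by (simp add: algebra_simps)
    also have "\<dots> = t * (m * h)" using s t by simp
    finally show "l * h1 + s * h3 = m * h" using t by simp
  qed
  let ?a = "real a" and ?b = "real b" and ?p = "real p" and ?q = "real q"
  have R: "\<tau> (?a + 1) b p q * m = \<tau> a b p q * l" "\<tau> a b (?p + 1) q * n = \<tau> a b p q * l" "\<tau> a b p (?q + 1) * m = \<tau> a b p q * s"
    using r by (auto simp: rep_def T_def add.commute)
  have hpos: "H a b q p > 0" "H (?a+1) b q p > 0" "H a b q (?p+1) > 0" "H a b (?q+1) p > 0"
    and gpos: "G a b q p > 0" "G (?a+1) b q p > 0" "G a b q (?p+1) > 0" "G a b (?q+1) p > 0"
    by (rule U.mom_pos Y.mom_pos; simp)+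
  have f: "F a b p q = \<tau> a b p q * H a b q p" "F (?a+1) b p q = \<tau> (?a+1) b p q * H (?a+1) b q p"
     "F a b (?p+1) q = \<tau> a b (?p+1) q * H a b q (?p+1)" "F a b p (?q+1) = \<tau> a b p (?q+1) * H a b (?q+1) p"
    using hpos by (simp_all add: \<tau>_def)
  have k: "K a b p q = \<tau> a b p q * G a b q p" "K (?a+1) b p q = \<tau> (?a+1) b p q * G (?a+1) b q p"
     "K a b (?p+1) q = \<tau> a b (?p+1) q * G a b q (?p+1)" "K a b p (?q+1) = \<tau> a b p (?q+1) * G a b (?q+1) p"
    using gpos by (simp_all add: \<tau>_alt)
  have t: "\<tau> a b p q > 0" by (intro \<tau>_relations) auto
  have s: "H (?a+1) b q p + H a b q (?p+1) = H a b q p" "G (?a+1) b q p + G a b q (?p+1) = G a b q p"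
    "F (?a+1) b p q + F a b p (?q+1) = F a b p q" "K (?a+1) b p q + K a b p (?q+1) = K a b p q"
    by (intro U.mom_AQ Y.mom_AQ X.mom_AQ V.mom_AQ; simp)+
  show "m * F (?a + 1) b p q + n * F a b (?p + 1) q = l * F a b p q"
    and "l * H (?a + 1) b q p + s * H a b (?q + 1) p = m * H a b q p"
    using key[OF R f t s(1,3)] by auto
  show "m * K (?a + 1) b p q + n * K a b (?p + 1) q = l * K a b p q"
    and "l * G (?a + 1) b q p + s * G a b (?q + 1) p = m * G a b q p"
    using key[OF R k t s(2,4)] by auto
qed

lemma laws_GB_II:
  assumes nd: "\<not> (\<exists>c. AE x in \<mu>X. x = c)"
  shows "\<exists>a b l. a > 0 \<and> b > 0 \<and> min a b > \<bar>l\<bar> \<and> \<mu>X = GB_II l a b \<alpha> \<and> \<mu>Y = GB_II (- l) a b \<beta>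
    \<and> \<mu>U = GB_II (- l) a b \<alpha> \<and> \<mu>V = GB_II l a b \<beta>"
proof -
  obtain l m n s e :: real where e: "e \<ge> 0" and
    r: "\<And>a b p q. rep T a b p q (l + e * (a + p)) (m + e * (a + q)) (n + e * (b + p)) (s + e * (b + q))"
    by (rule affine_parameters) (rule that)
  have pos: "l > 0" "m > 0" "n > 0" "s > 0" "l + s = m + n" using r[of 0 0 0 0] by (auto simp: rep_def)
  have "e \<noteq> 0"
  proof
    assume "e = 0"
    then have "rep T a b p q l m n s" for a b p q using r[of a b p q] by simp
    from X.Dirac_from_moments[OF pos(1-3)] contiguous_relations(1)[OF this, of _ 0 _ 0] nd show False by simp
  qed
  with e have e: "e > 0" by simp
  \<comment> \<open>the slope $e$ is scaled to $1$\<close>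
  define a b \<kappa> where "a = (n + s) / (2 * e)" and "b = (l + m) / (2 * e)" and "\<kappa> = (l - m) / (2 * e)"
  have s_eq: "s = m + n - l" using pos(5) by simp
  have par: "l = e * (b + \<kappa>)" "m = e * (b - \<kappa>)" "n = e * (a + \<kappa>)" "s = e * (a - \<kappa>)"
    using e unfolding s_eq a_def b_def \<kappa>_def by (simp_all add: field_simps)
  have ineq: "b + \<kappa> > 0" "b - \<kappa> > 0" "a + \<kappa> > 0" "a - \<kappa> > 0"
    using pos e unfolding par by (auto simp: zero_less_mult_iff)
  have ab: "a > 0" "b > 0" "- b < \<kappa>" "\<kappa> < a" "- b < - \<kappa>" "- \<kappa> < a" using ineq by auto
  have canc: "x = y" if "e * x = e * y" for x y :: real using that e by simp
  have "\<mu>X = GB_II \<kappa> a b \<alpha>"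
  proof (rule X.GB_II_from_moments[OF ab(1,2,3,4)])
    fix k :: nat show "(b - \<kappa>) * F 1 0 k 0 + (a + \<kappa> + k) * F 0 0 (real k + 1) 0 = (b + \<kappa> + k) * F 0 0 k 0"
      using contiguous_relations(1)[OF r[of 0 0 k 0]] by - (rule canc, simp add: par algebra_simps)
  qed
  moreover have "\<mu>V = GB_II \<kappa> a b \<beta>"
  proof (rule V.GB_II_from_moments[OF ab(1,2,3,4)])
    fix k :: nat show "(b - \<kappa>) * K 1 0 k 0 + (a + \<kappa> + k) * K 0 0 (real k + 1) 0 = (b + \<kappa> + k) * K 0 0 k 0"
      using contiguous_relations(3)[OF r[of 0 0 k 0]] by - (rule canc, simp add: par algebra_simps)
  qed
  moreover have "\<mu>U = GB_II (- \<kappa>) a b \<alpha>"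
  proof (rule U.GB_II_from_moments[OF ab(1,2,5,6)])
    fix k :: nat show "(b - - \<kappa>) * H 1 0 k 0 + (a + - \<kappa> + k) * H 0 0 (real k + 1) 0 = (b + - \<kappa> + k) * H 0 0 k 0"
      using contiguous_relations(2)[OF r[of 0 0 0 k]] by - (rule canc, simp add: par algebra_simps)
  qed
  moreover have "\<mu>Y = GB_II (- \<kappa>) a b \<beta>"
  proof (rule Y.GB_II_from_moments[OF ab(1,2,5,6)])
    fix k :: nat show "(b - - \<kappa>) * G 1 0 k 0 + (a + - \<kappa> + k) * G 0 0 (real k + 1) 0 = (b + - \<kappa> + k) * G 0 0 k 0"
      using contiguous_relations(4)[OF r[of 0 0 0 k]] by - (rule canc, simp add: par algebra_simps)
  qed
  moreover have "min a b > \<bar>\<kappa>\<bar>" using ineq by auto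
  ultimately show ?thesis using ab by blast
qed

end


section \<open>The quadrirational map and the characterization\<close>

text \<open>
  All identities follow from the factorizations of $1 + u$, $1 + v$, $1 + \alpha u$ and $1 + \beta v$ over the common
  denominators $D_1, D_2$ and numerators $N_1, N_2$ of the map.
\<close>

lemma F_map_identities:
  assumes "\<alpha> > 0" "\<beta> > 0" "x > 0" "y > 0" and F: "(u, v) = F_map \<alpha> \<beta> (x, y)"
  shows "u > 0" "v > 0"
    "(x/(1+x)) * (y/(1+y)) = (u/(1+u)) * (v/(1+v))"
    "(1/(1+\<alpha>*x)) * (1/(1+\<beta>*y)) = (1/(1+\<alpha>*u)) * (1/(1+\<beta> * v))"
    "(\<alpha>*x/(1+\<alpha>*x)) * (1/(1+y)) = (1/(1+u)) * (\<beta> * v/(1+\<beta> * v))"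
    "(1/(1+x)) * (\<beta>*y/(1+\<beta>*y)) = (\<alpha>*u/(1+\<alpha>*u)) * (1/(1+v))"
proof -
  define D1 D2 N1 N2 where "D1 = 1 + x + y + \<beta> * x * y" and "D2 = 1 + x + y + \<alpha> * x * y"
    and "N1 = \<beta> + \<alpha> * x + \<beta> * y + \<alpha> * \<beta> * x * y" and "N2 = \<alpha> + \<alpha> * x + \<beta> * y + \<alpha> * \<beta> * x * y"
  have p: "D1 > 0" "D2 > 0" "N1 > 0" "N2 > 0"
    unfolding D1_def D2_def N1_def N2_def using assms by (auto intro!: add_pos_pos mult_pos_pos)
  have uv: "u = y * N1 / (\<alpha> * D1)" "v = x * N2 / (\<beta> * D2)"
    using F by (auto simp: F_map_def D1_def D2_def N1_def N2_def)
  show "u > 0" "v > 0" using uv p assms by auto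
  have q: "1 + x > 0" "1 + y > 0" "1 + \<alpha> * x > 0" "1 + \<beta> * y > 0" using assms by (auto intro!: add_pos_pos)
  have "\<alpha> * D1 + y * N1 = (1 + y) * N2" "\<beta> * D2 + x * N2 = (1 + x) * N1"
    "D1 + y * N1 = (1 + \<beta> * y) * D2" "D2 + x * N2 = (1 + \<alpha> * x) * D1"
    unfolding D1_def D2_def N1_def N2_def by (simp_all add: algebra_simps)
  then have e: "1 + u = (1 + y) * N2 / (\<alpha> * D1)" "1 + v = (1 + x) * N1 / (\<beta> * D2)"
    "1 + \<alpha> * u = (1 + \<beta> * y) * D2 / D1" "1 + \<beta> * v = (1 + \<alpha> * x) * D1 / D2"
    unfolding uv using p assms by (simp_all add: add_divide_distrib[symmetric] field_simps)
  have n: "D1 \<noteq> 0" "D2 \<noteq> 0" "N1 \<noteq> 0" "N2 \<noteq> 0" "1 + x \<noteq> 0" "1 + y \<noteq> 0" "1 + \<alpha> * x \<noteq> 0" "1 + \<beta> * y \<noteq> 0" "\<alpha> \<noteq> 0" "\<beta> \<noteq> 0"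
    using p q assms by auto
  show "(x/(1+x)) * (y/(1+y)) = (u/(1+u)) * (v/(1+v))"
    "(1/(1+\<alpha>*x)) * (1/(1+\<beta>*y)) = (1/(1+\<alpha>*u)) * (1/(1+\<beta> * v))"
    "(\<alpha>*x/(1+\<alpha>*x)) * (1/(1+y)) = (1/(1+u)) * (\<beta> * v/(1+\<beta> * v))"
    "(1/(1+x)) * (\<beta>*y/(1+\<beta>*y)) = (\<alpha>*u/(1+\<alpha>*u)) * (1/(1+v))"
    unfolding e using n by (simp_all add: uv mult.commute)
qed

lemma kern_F_map:
  assumes "\<alpha> > 0" "\<beta> > 0" "x > 0" "y > 0" and F: "(u, v) = F_map \<alpha> \<beta> (x, y)"
  shows "kern \<alpha> a b p q x * kern \<beta> a b q p y = kern \<alpha> a b q p u * kern \<beta> a b p q v"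
proof -
  note I = F_map_identities[OF assms]
  have pm: "(s * t) powr c = s powr c * t powr c" if "s > 0" "t > 0" for s t c :: real
    using that by (simp add: powr_mult)
  note cx = coords[OF assms(1,3)] and cy = coords[OF assms(2,4)]
    and cu = coords[OF assms(1) I(1)] and cv = coords[OF assms(2) I(2)]
  have "(x/(1+x)) powr a * (y/(1+y)) powr a = (u/(1+u)) powr a * (v/(1+v)) powr a"
    using I(3) pm[OF cx(1) cy(1)] pm[OF cu(1) cv(1)] by metis
  moreover have "(1/(1+\<alpha>*x)) powr b * (1/(1+\<beta>*y)) powr b = (1/(1+\<alpha>*u)) powr b * (1/(1+\<beta> * v)) powr b"
    using I(4) pm[OF cx(7) cy(7)] pm[OF cu(7) cv(7)] by metis
  moreover have "(\<alpha>*x/(1+\<alpha>*x)) powr p * (1/(1+y)) powr p = (1/(1+u)) powr p * (\<beta> * v/(1+\<beta> * v)) powr p"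
    using I(5) pm[OF cx(5) cy(3)] pm[OF cu(3) cv(5)] by metis
  moreover have "(1/(1+x)) powr q * (\<beta>*y/(1+\<beta>*y)) powr q = (\<alpha>*u/(1+\<alpha>*u)) powr q * (1/(1+v)) powr q"
    using I(6) pm[OF cx(3) cy(5)] pm[OF cu(5) cv(3)] by metis
  moreover have regroup: "A * B * P * Q * (A' * B' * Q' * P') = (A * A') * (B * B') * (P * P') * (Q * Q')"
    for A B P Q A' B' P' Q' :: real by (simp add: mult_ac)
  ultimately show ?thesis
    using assms(3,4) I(1,2) unfolding kern_def by (simp only: if_True regroup) (simp only: mult_ac)
qed

theorem theorem1p2:
  fixes M :: "'a measure" and X Y U V :: "'a \<Rightarrow> real" and \<alpha> \<beta> :: real
  assumes "prob_space M"
    and "\<alpha> > 0" and "\<beta> > 0" and "\<alpha> \<noteq> \<beta>"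
    and "prob_space.indep_var M borel X borel Y"
    and "AE \<omega> in M. X \<omega> > 0" and "AE \<omega> in M. Y \<omega> > 0"
    and "non_Dirac M X" and "non_Dirac M Y"
    and "\<And>\<omega>. \<omega> \<in> space M \<Longrightarrow> (U \<omega>, V \<omega>) = F_map \<alpha> \<beta> (X \<omega>, Y \<omega>)"
    and "prob_space.indep_var M borel U borel V"
  shows "\<exists>a b l :: real. a > 0 \<and> b > 0 \<and> min a b > \<bar>l\<bar> \<and>
    indep_with_laws M X Y (GB_II l a b \<alpha>) (GB_II (- l) a b \<beta>) \<and>
    indep_with_laws M U V (GB_II (- l) a b \<alpha>) (GB_II l a b \<beta>)"
proof -
  interpret prob_space M by fact
  have [measurable]: "X \<in> borel_measurable M" "Y \<in> borel_measurable M" "U \<in> borel_measurable M" "V \<in> borel_measurable M"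
    using indep_var_rv1[OF assms(5)] indep_var_rv2[OF assms(5)] indep_var_rv1[OF assms(11)] indep_var_rv2[OF assms(11)] by auto
  have uv: "AE \<omega> in M. U \<omega> > 0 \<and> V \<omega> > 0"
    using assms(6,7) AE_space
    by eventually_elim (use F_map_identities(1,2)[OF assms(2,3) _ _ assms(10)] in blast)
  then have uv': "AE \<omega> in M. U \<omega> > 0" "AE \<omega> in M. V \<omega> > 0" by auto
  have law: "pos_law (distr M borel Z) \<gamma>" 
    if [measurable]: "Z \<in> borel_measurable M" and "AE \<omega> in M. Z \<omega> > 0" "\<gamma> > 0" for Z \<gamma>
    using that by (auto simp: pos_law_def pos_law_axioms_def AE_distr_iff intro!: prob_space_distr)
  have prod: "mom \<gamma> (distr M borel Z) a b p q * mom \<gamma>' (distr M borel Z') a b q p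
      = (LINT \<omega>|M. kern \<gamma> a b p q (Z \<omega>) * kern \<gamma>' a b q p (Z' \<omega>))"
    if ind: "indep_var borel Z borel Z'" and pos: "AE \<omega> in M. Z \<omega> > 0" "AE \<omega> in M. Z' \<omega> > 0" "\<gamma> > 0" "\<gamma>' > 0"
      and nn: "a \<ge> 0" "b \<ge> 0" "p \<ge> 0" "q \<ge> 0" for Z Z' \<gamma> \<gamma>' a b p q
  proof -
    have [measurable]: "Z \<in> borel_measurable M" "Z' \<in> borel_measurable M"
      using indep_var_rv1[OF ind] indep_var_rv2[OF ind] by auto
    interpret Z: pos_law "distr M borel Z" \<gamma> using pos by (intro law) auto
    interpret Z': pos_law "distr M borel Z'" \<gamma>' using pos by (intro law) auto
    have i: "integrable M (\<lambda>\<omega>. kern \<gamma> a b p q (Z \<omega>))" "integrable M (\<lambda>\<omega>. kern \<gamma>' a b q p (Z' \<omega>))"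
      using Z.kern_integrable[OF nn] Z'.kern_integrable[OF nn(1,2,4,3)] by (auto simp: integrable_distr_eq)
    have "indep_var borel (\<lambda>\<omega>. kern \<gamma> a b p q (Z \<omega>)) borel (\<lambda>\<omega>. kern \<gamma>' a b q p (Z' \<omega>))"
      using indep_var_compose[OF ind kern_measurable kern_measurable] by (simp add: comp_def)
    from indep_var_lebesgue_integral[OF this i] show ?thesis
      by (simp add: mom_def integral_distr)
  qed
  interpret quad_laws "distr M borel X" "distr M borel Y" "distr M borel U" "distr M borel V" \<alpha> \<beta>
  proof (intro quad_laws.intro quad_laws_axioms.intro law)
    fix a b p q :: real assume nn: "a \<ge> 0" "b \<ge> 0" "p \<ge> 0" "q \<ge> 0"
    have "(LINT \<omega>|M. kern \<alpha> a b p q (X \<omega>) * kern \<beta> a b q p (Y \<omega>)) = (LINT \<omega>|M. kern \<alpha> a b q p (U \<omega>) * kern \<beta> a b p q (V \<omega>))"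
    proof (rule integral_cong_AE)
      show "AE \<omega> in M. kern \<alpha> a b p q (X \<omega>) * kern \<beta> a b q p (Y \<omega>) = kern \<alpha> a b q p (U \<omega>) * kern \<beta> a b p q (V \<omega>)"
        using assms(6,7) AE_space
        by eventually_elim (use kern_F_map[OF assms(2,3) _ _ assms(10)] in blast)
    qed measurable
    then show "mom \<alpha> (distr M borel X) a b p q * mom \<beta> (distr M borel Y) a b q p
      = mom \<alpha> (distr M borel U) a b q p * mom \<beta> (distr M borel V) a b p q"
      using prod[OF assms(5,6,7,2,3) nn] prod[OF assms(11) uv' assms(2,3) nn(1,2,4,3)] by simp
  qed (use assms(2,3,4,6,7) uv' in auto)
  have "\<not> (\<exists>c. AE x in distr M borel X. x = c)"
    using assms(8) by (simp add: non_Dirac_def AE_distr_iff)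
  from laws_GB_II[OF this] show ?thesis
    using assms(5,11) unfolding indep_with_laws_def by blast
qed

end
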